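(* Let $\eta>0$ and let $f,g:\mathbb{R}^d\to\mathbb{R}$ be convex functions such that $\pi^{XY}(x,y)\propto\exp(-f(x)-g(y)-\frac{1}{2\eta}\|x-y\|_2^2)$ is a normalizable density with finite second moments. Consider the Gibbs sampler: draw $x^0\sim\mu_0^X$ (with finite second moment); for $k=0,1,2,\dots$, draw $y^k\sim\pi^{Y|X=x^k}\propto\exp(-g(y)-\frac{1}{2\eta}\|x^k-y\|_2^2)$ and then $x^{k+1}\sim\pi^{X|Y=y^k}\propto\exp(-f(x)-\frac{1}{2\eta}\|x-y^k\|_2^2)$. Let $\mu_k^{XY}$ be the law of $(x^k,y^k)$. Then for every $k\ge1$, $$D_{\mathrm{KL}}(\mu_k^{XY}\|\pi^{XY})\le\frac{W_2^2(\mu_0^X,\pi^X)}{k\eta}.$$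
   Context: $\pi^X$ is the $X$-marginal of $\pi^{XY}$. $D_{\mathrm{KL}}(\mu\|\nu)=\int\mu\log\frac{\mu}{\nu}$. The 2-Wasserstein distance is $W_2^2(\mu,\nu)=\inf_{\gamma\in\Gamma(\mu,\nu)}\int\|x-y\|_2^2\,\mathrm{d}\gamma(x,y)$, where $\Gamma(\mu,\nu)$ is the set of couplings of $\mu$ and $\nu$. *)

theory Defs
  imports "HOL-Probability.Probability"
begin

definition gibbs_joint_unnorm :: "real \<Rightarrow> ('a::euclidean_space \<Rightarrow> real) \<Rightarrow> ('a \<Rightarrow> real) \<Rightarrow> 'a \<times> 'a \<Rightarrow> real" where
  "gibbs_joint_unnorm \<eta> f g z = exp (- f (fst z) - g (snd z) - (norm (fst z - snd z))\<^sup>2 / (2 * \<eta>))"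

definition gibbs_target :: "real \<Rightarrow> ('a::euclidean_space \<Rightarrow> real) \<Rightarrow> ('a \<Rightarrow> real) \<Rightarrow> ('a \<times> 'a) measure" where
  "gibbs_target \<eta> f g = density lborel (\<lambda>z. ennreal (gibbs_joint_unnorm \<eta> f g z /
       (\<integral>w. gibbs_joint_unnorm \<eta> f g w \<partial>lborel)))"

text \<open>Conditional law proportional to exp(-h y - |x-y|^2/(2 eta)), given the conditioning point x.
  With h = g this is pi^{Y|X=x}; with h = f it is pi^{X|Y=x}.\<close>
definition gibbs_cond :: "real \<Rightarrow> ('a::euclidean_space \<Rightarrow> real) \<Rightarrow> 'a \<Rightarrow> 'a measure" where
  "gibbs_cond \<eta> h x = density lborel (\<lambda>y. ennreal (exp (- h y - (norm (x - y))\<^sup>2 / (2 * \<eta>)) /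
       (\<integral>w. exp (- h w - (norm (x - w))\<^sup>2 / (2 * \<eta>)) \<partial>lborel)))"

definition gibbs_step :: "real \<Rightarrow> ('a::euclidean_space \<Rightarrow> real) \<Rightarrow> ('a \<Rightarrow> real) \<Rightarrow> 'a measure \<Rightarrow> 'a measure" where
  "gibbs_step \<eta> f g \<mu> = (\<mu> \<bind> gibbs_cond \<eta> g) \<bind> gibbs_cond \<eta> f"

definition gibbs_law_X :: "real \<Rightarrow> ('a::euclidean_space \<Rightarrow> real) \<Rightarrow> ('a \<Rightarrow> real) \<Rightarrow> 'a measure \<Rightarrow> nat \<Rightarrow> 'a measure" where
  "gibbs_law_X \<eta> f g \<mu>0 k = (gibbs_step \<eta> f g ^^ k) \<mu>0"

definition gibbs_law_XY :: "real \<Rightarrow> ('a::euclidean_space \<Rightarrow> real) \<Rightarrow> ('a \<Rightarrow> real) \<Rightarrow> 'a measure \<Rightarrow> nat \<Rightarrow> ('a \<times> 'a) measure" where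
  "gibbs_law_XY \<eta> f g \<mu>0 k =
     gibbs_law_X \<eta> f g \<mu>0 k \<bind> (\<lambda>x. gibbs_cond \<eta> g x \<bind> (\<lambda>y. return borel (x, y)))"

definition KL_div :: "'b measure \<Rightarrow> 'b measure \<Rightarrow> ereal" where
  "KL_div \<mu> \<nu> =
     (let r = (\<lambda>x. enn2real (RN_deriv \<nu> \<mu> x)) in
      if absolutely_continuous \<nu> \<mu> \<and> sets \<mu> = sets \<nu> \<and> integrable \<nu> (\<lambda>x. r x * ln (r x))
      then ereal (\<integral>x. r x * ln (r x) \<partial>\<nu>) else \<infinity>)"

definition couplings :: "'a::euclidean_space measure \<Rightarrow> 'a measure \<Rightarrow> ('a \<times> 'a) measure set" where
  "couplings \<mu> \<nu> = {\<gamma>. sets \<gamma> = sets borel \<and> distr \<gamma> borel fst = \<mu> \<and> distr \<gamma> borel snd = \<nu>}"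

definition W2sq :: "'a::euclidean_space measure \<Rightarrow> 'a measure \<Rightarrow> ennreal" where
  "W2sq \<mu> \<nu> = (INF \<gamma>\<in>couplings \<mu> \<nu>. \<integral>\<^sup>+ z. ennreal ((norm (fst z - snd z))\<^sup>2) \<partial>\<gamma>)"

end

theory Submission
  imports Defs
begin

text \<open>
  The proof goes through a log-Harnack inequality for the sampler. Write \<open>Q x\<close> for the kernel with
  density proportional to \<open>exp (- h y - |x - y|^2 / (2 \<eta>))\<close>, \<open>h\<close> convex. The Prekopa--Leindler inequality
  yields two facts: the partition function is log-concave, whence
  \<open>KL (Q x) (Q x') \<le> |x - x'|^2 / (2 \<eta>)\<close>, and \<open>Q x\<close> satisfies Talagrand's transport inequality in dual
  form. Together they make \<open>Q\<close> a contraction in the 2-Wasserstein distance (again in dual form).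
  Now suppose that bounded \<open>a, p\<close> satisfy \<open>a y - ln (p y') \<le> |y - y'|^2 / (2 n \<eta>)\<close>. Passing through
  the point \<open>x' + (x - x') / (n + 1)\<close>, contraction for one leg and the entropy bound for the other give
  the same inequality for \<open>Q a, Q p\<close> with \<open>n + 1\<close> instead of \<open>n\<close>. A run of \<open>k\<close> sweeps uses
  \<open>2 k\<close> kernels, so integrating against a coupling of the initial law and the (stationary) target
  marginal and using the variational formula for the relative entropy gives the bound, even with the
  denominator \<open>4 k \<eta>\<close>.
\<close>

section \<open>The Prekopa--Leindler inequality\<close>

text \<open>Working with bounded test functions instead of the laws themselves makes integrability
  of every pulled-back function automatic, and no density of an intermediate law is written down.
  The rate comes from adding reciprocals: a cost coefficient 1/(2 n \<eta>) on one leg and 1/(2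
  \<eta>) on the other, with the intermediate point minimising the sum, combine to 1/(2 (n + 1)
  \<eta>), so each kernel adds 2 \<eta> to the reciprocal of the coefficient. Contraction loses no
  factor because the entropy bound and the transport inequality of a kernel carry the same constant
  1/(2 \<eta>). The count is 2 k and not 2 k + 1: the final draw of y uses the same kernel under
  both laws, but the test function depends on x as well, so this draw yields only Jensen's
  inequality at a common x, which is the start n = 0 of the induction.\<close>

lemma emeasure_lborel_scale:
  fixes B :: "real set"
  assumes "B \<in> sets borel" "c > 0"
  shows "emeasure lborel {w. w / c \<in> B} = ennreal c * emeasure lborel B"
proof -
  have m: "{w. w / c \<in> B} \<in> sets borel"
  proof -
    have "(\<lambda>w. w / c) -` B \<inter> space borel \<in> sets borel"
      by (rule measurable_sets[OF _ assms(1)]) simp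
    then show ?thesis by (simp add: vimage_def)
  qed
  have "emeasure lborel {w. w / c \<in> B} = (\<integral>\<^sup>+x. indicator {w. w / c \<in> B} x \<partial>lborel)"
    using m by simp
  also have "\<dots> = ennreal \<bar>c\<bar> * (\<integral>\<^sup>+x. indicator {w. w / c \<in> B} (0 + c * x) \<partial>lborel)"
    by (rule nn_integral_real_affine) (use m assms in auto)
  also have "(\<lambda>x. indicator {w. w / c \<in> B} (0 + c * x) :: ennreal) = indicator B"
    using assms by (auto simp: indicator_def fun_eq_iff)
  finally show ?thesis using assms by simp
qed

lemma emeasure_lborel_shift:
  fixes B :: "real set"
  assumes "B \<in> sets borel"
  shows "emeasure lborel {w. w - t \<in> B} = emeasure lborel B" "{w. w - t \<in> B} \<in> sets borel"
proof -
  show m: "{w. w - t \<in> B} \<in> sets borel"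
  proof -
    have "(\<lambda>w. w - t) -` B \<inter> space borel \<in> sets borel"
      by (rule measurable_sets[OF _ assms(1)]) simp
    then show ?thesis by (simp add: vimage_def)
  qed
  have "emeasure lborel {w. w - t \<in> B} = (\<integral>\<^sup>+x. indicator {w. w - t \<in> B} x \<partial>lborel)"
    using m by simp
  also have "\<dots> = ennreal \<bar>1\<bar> * (\<integral>\<^sup>+x. indicator {w. w - t \<in> B} (t + 1 * x) \<partial>lborel)"
    by (rule nn_integral_real_affine) (use m in auto)
  also have "(\<lambda>x. indicator {w. w - t \<in> B} (t + 1 * x) :: ennreal) = indicator B"
    by (auto simp: indicator_def fun_eq_iff)
  finally show "emeasure lborel {w. w - t \<in> B} = emeasure lborel B" using assms by simp
qed

text \<open>Translate \<open>A\<close> by a point of \<open>B\<close> close to its infimum and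
  \<open>B\<close> by a point of \<open>A\<close> close to its supremum: both copies lie in
  \<open>C\<close> and overlap in an interval of length at most \<open>e\<close>. Asking for a
  measurable \<open>C\<close> containing all sums avoids the measurability of the sumset.\<close>

lemma Brunn_Minkowski_real_bounded:
  fixes A B C :: "real set"
  assumes "A \<in> sets borel" "B \<in> sets borel" "C \<in> sets borel"
    and "A \<noteq> {}" "B \<noteq> {}" "bdd_above A" "bdd_below B"
    and C: "\<And>x y. x \<in> A \<Longrightarrow> y \<in> B \<Longrightarrow> x + y \<in> C"
  shows "emeasure lborel A + emeasure lborel B \<le> emeasure lborel C"
proof (rule ennreal_le_epsilon)
  fix e :: real assume e: "e > 0"
  obtain a where a: "a \<in> A" "a > Sup A - e / 2"
    using less_cSupD[of A "Sup A - e/2"] assms e by auto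
  obtain b where b: "b \<in> B" "b < Inf B + e / 2"
    using cInf_lessD[of B "Inf B + e/2"] assms e by auto
  let ?S = "{w. w - b \<in> A}" and ?T = "{w. w - a \<in> B}"
  note S = emeasure_lborel_shift[OF assms(1), of b] and T = emeasure_lborel_shift[OF assms(2), of a]
  have "?S \<union> ?T \<subseteq> C"
    using C[of _ b] C[of a] a b by (force simp: add.commute)
  then have un: "emeasure lborel (?S \<union> ?T) \<le> emeasure lborel C"
    by (rule emeasure_mono) (use assms in simp)
  have "?S \<inter> ?T \<subseteq> {a + Inf B .. Sup A + b}"
    using cSup_upper[of _ A] cInf_lower[of _ B] assms by (fastforce simp: algebra_simps)
  then have "emeasure lborel (?S \<inter> ?T) \<le> emeasure lborel {a + Inf B .. Sup A + b}"
    by (rule emeasure_mono) simp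
  also have "\<dots> \<le> ennreal e"
    using a b by (auto simp: emeasure_lborel_Icc_eq intro!: ennreal_leI)
  finally have int: "emeasure lborel (?S \<inter> ?T) \<le> ennreal e" .
  have "emeasure lborel ?S + emeasure lborel ?T
      = emeasure lborel (?S \<union> ?T) + emeasure lborel (?S \<inter> ?T)"
    using S T by (intro emeasure_Un_Int) auto
  also have "\<dots> \<le> emeasure lborel C + ennreal e"
    by (rule add_mono[OF un int])
  finally show "emeasure lborel A + emeasure lborel B \<le> emeasure lborel C + ennreal e"
    by (simp only: S(1) T(1))
qed

text \<open>Exhaustion by the intervals \<open>?I k\<close>; both truncated sets are nonempty once
  the interval contains one chosen point of each.\<close>

lemma Brunn_Minkowski_real:
  fixes A B C :: "real set"
  assumes [measurable]: "A \<in> sets borel" "B \<in> sets borel" "C \<in> sets borel"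
    and "A \<noteq> {}" "B \<noteq> {}"
    and C: "\<And>x y. x \<in> A \<Longrightarrow> y \<in> B \<Longrightarrow> x + y \<in> C"
  shows "emeasure lborel A + emeasure lborel B \<le> emeasure lborel C"
proof -
  let ?I = "\<lambda>k::nat. {- real k..real k}"
  have lim: "(\<lambda>k. emeasure lborel (S \<inter> ?I k)) \<longlonglongrightarrow> emeasure lborel S" if [measurable]: "S \<in> sets borel" for S
  proof -
    have "(\<Union>k. S \<inter> ?I k) = S"
    proof (intro equalityI subsetI)
      fix x assume "x \<in> S"
      obtain k where "\<bar>x\<bar> \<le> real k" using real_arch_simple by blast
      then show "x \<in> (\<Union>k. S \<inter> ?I k)" using \<open>x \<in> S\<close> by (auto simp: abs_le_iff intro!: exI[of _ k])
    qed auto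
    moreover have "(\<lambda>k. emeasure lborel (S \<inter> ?I k)) \<longlonglongrightarrow> emeasure lborel (\<Union>k. S \<inter> ?I k)"
      by (rule Lim_emeasure_incseq) (auto simp: incseq_def)
    ultimately show ?thesis by simp
  qed
  obtain a b where ab: "a \<in> A" "b \<in> B" using assms by auto
  obtain k0 where k0: "max \<bar>a\<bar> \<bar>b\<bar> \<le> real k0" using real_arch_simple by blast
  have "emeasure lborel (A \<inter> ?I k) + emeasure lborel (B \<inter> ?I k) \<le> emeasure lborel C" if "k \<ge> k0" for k
  proof (rule Brunn_Minkowski_real_bounded)
    have "real k0 \<le> real k" using that by simp
    then have "a \<in> ?I k" "b \<in> ?I k" using k0 by auto
    then show "A \<inter> ?I k \<noteq> {}" "B \<inter> ?I k \<noteq> {}" using ab by auto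
    show "bdd_above (A \<inter> ?I k)" "bdd_below (B \<inter> ?I k)"
      by (meson bdd_above_Icc bdd_above_mono inf_le2, meson bdd_below_Icc bdd_below_mono inf_le2)
  qed (use C in auto)
  then show ?thesis
    using lim[of A] lim[of B]
    by (intro LIMSEQ_le_const2[OF tendsto_add]) auto
qed

section \<open>From level sets to the one-dimensional Prekopa--Leindler inequality\<close>

text \<open>Layer-cake formula cut off at height 1: after normalisation to supremum 1 these are the
  heights at which both level sets are nonempty, as Brunn--Minkowski demands.\<close>

lemma nn_integral_level_sets_unit:
  fixes \<phi> :: "real \<Rightarrow> ennreal"
  assumes [measurable]: "\<phi> \<in> borel_measurable borel"
  shows "(\<integral>\<^sup>+t. emeasure lborel {x. ennreal t < \<phi> x} * indicator {0<..<1} t \<partial>lborel)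
    = (\<integral>\<^sup>+x. min 1 (\<phi> x) \<partial>lborel)"
proof -
  have "(\<integral>\<^sup>+t. emeasure lborel {x. ennreal t < \<phi> x} * indicator {0<..<1} t \<partial>lborel)
    = (\<integral>\<^sup>+t. (\<integral>\<^sup>+x. indicator {x. ennreal t < \<phi> x} x * indicator {0<..<1} t \<partial>lborel) \<partial>lborel)"
    by (simp add: nn_integral_multc)
  also have "\<dots> = (\<integral>\<^sup>+x. (\<integral>\<^sup>+t. indicator {x. ennreal t < \<phi> x} x * indicator {0<..<1} t \<partial>lborel) \<partial>lborel)"
    unfolding indicator_def by (intro lborel_pair.Fubini') simp
  also have "\<dots> = (\<integral>\<^sup>+x. min 1 (\<phi> x) \<partial>lborel)"
  proof (rule nn_integral_cong)
    fix x
    show "(\<integral>\<^sup>+t. indicator {x. ennreal t < \<phi> x} x * indicator {0<..<1} t \<partial>lborel) = min 1 (\<phi> x)"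
    proof (cases "\<phi> x \<ge> 1")
      case True
      have "ennreal t < \<phi> x" if "0 < t" "t < 1" for t
        using that True by (metis ennreal_1 ennreal_less_iff less_le_trans less_imp_le)
      then have "(\<lambda>t. indicator {x. ennreal t < \<phi> x} x * indicator {0<..<1} t :: ennreal) = indicator {0<..<1}"
        by (auto simp: indicator_def fun_eq_iff)
      then show ?thesis using True by (simp add: min_absorb1)
    next
      case False
      then obtain r where r: "\<phi> x = ennreal r" "0 \<le> r" "r < 1"
        by (cases "\<phi> x") (auto simp: not_le ennreal_less_one_iff)
      have "(\<lambda>t. indicator {x. ennreal t < \<phi> x} x * indicator {0<..<1} t :: ennreal) = indicator {0<..<r}"
        using r by (auto simp: indicator_def fun_eq_iff ennreal_less_iff)
      then show ?thesis using False r by (simp add: min_absorb2)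
    qed
  qed
  finally show ?thesis .
qed

text \<open>At each height \<open>t\<close> below 1 the level set of \<open>h\<close> contains the
  weighted means of points from those of \<open>f\<close> and \<open>g\<close>, so Brunn--Minkowski
  bounds its length from below. Integrating in \<open>t\<close> gives an additive inequality, which
  AM-GM later turns into the product form.\<close>

lemma level_sets_integral_ineq:
  fixes f g h :: "real \<Rightarrow> ennreal" and n :: nat
  assumes [measurable]: "f \<in> borel_measurable borel" "g \<in> borel_measurable borel" "h \<in> borel_measurable borel"
    and "\<And>x. f x \<le> 1" "\<And>x. g x \<le> 1"
    and ex: "\<And>t. 0 < t \<Longrightarrow> t < 1 \<Longrightarrow> \<exists>x. ennreal t < f x" "\<And>t. 0 < t \<Longrightarrow> t < 1 \<Longrightarrow> \<exists>x. ennreal t < g x"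
    and fgh: "\<And>t x y. 0 < t \<Longrightarrow> t < 1 \<Longrightarrow> ennreal t < f x \<Longrightarrow> ennreal t < g y \<Longrightarrow>
      ennreal t < h ((x + real n * y) / (real n + 1))"
    and n: "n > 0"
  shows "(\<integral>\<^sup>+x. f x \<partial>lborel) + of_nat n * (\<integral>\<^sup>+x. g x \<partial>lborel) \<le> of_nat (Suc n) * (\<integral>\<^sup>+x. h x \<partial>lborel)"
proof -
  let ?L = "\<lambda>\<phi> t. emeasure lborel {x::real. ennreal t < \<phi> x}"
  have [measurable]: "?L \<phi> \<in> borel_measurable borel" if [measurable]: "\<phi> \<in> borel_measurable borel" for \<phi>
  proof -
    have eq: "?L \<phi> t = (\<integral>\<^sup>+x. (if ennreal t < \<phi> x then 1 else 0) \<partial>lborel)" for t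
    proof -
      have "?L \<phi> t = (\<integral>\<^sup>+x. indicator {x. ennreal t < \<phi> x} x \<partial>lborel)" by simp
      also have "\<dots> = (\<integral>\<^sup>+x. (if ennreal t < \<phi> x then 1 else 0) \<partial>lborel)"
        by (intro nn_integral_cong) (auto simp: indicator_def)
      finally show ?thesis .
    qed
    show ?thesis unfolding eq by measurable
  qed
  have key: "?L f t + of_nat n * ?L g t \<le> of_nat (Suc n) * ?L h t" if t: "0 < t" "t < 1" for t
  proof -
    \<comment> \<open>Dilating by \<open>n\<close> and by \<open>n + 1\<close> turns the weighted
      mean into the plain sum \<open>x + w\<close>.\<close>
    let ?A = "{x. ennreal t < f x}" and ?B = "{w. w / real n \<in> {x. ennreal t < g x}}"
      and ?C = "{w. w / (real n + 1) \<in> {x. ennreal t < h x}}"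
    have "emeasure lborel ?A + emeasure lborel ?B \<le> emeasure lborel ?C"
    proof (rule Brunn_Minkowski_real)
      show "?A \<noteq> {}" using ex(1)[OF t] by auto
      obtain y where "ennreal t < g y" using ex(2)[OF t] by auto
      then have "real n * y \<in> ?B" using n by simp
      then show "?B \<noteq> {}" by (rule Set.ex_in_conv[THEN iffD1, OF exI])
      fix x w assume "x \<in> ?A" "w \<in> ?B"
      then show "x + w \<in> ?C" using fgh[OF t, of x "w / real n"] n by simp
    qed simp_all
    moreover have "emeasure lborel ?B = ennreal (real n) * ?L g t"
      by (rule emeasure_lborel_scale) (use n in auto)
    moreover have "emeasure lborel ?C = ennreal (real n + 1) * ?L h t"
      by (rule emeasure_lborel_scale) (use n in auto)
    ultimately show ?thesis
      by (metis ennreal_of_nat_eq_real_of_nat of_nat_Suc add.commute)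
  qed
  have "(\<integral>\<^sup>+x. f x \<partial>lborel) = (\<integral>\<^sup>+x. min 1 (f x) \<partial>lborel)" "(\<integral>\<^sup>+x. g x \<partial>lborel) = (\<integral>\<^sup>+x. min 1 (g x) \<partial>lborel)"
    using assms by (auto intro!: nn_integral_cong simp: min_absorb2)
  then have "(\<integral>\<^sup>+x. f x \<partial>lborel) + of_nat n * (\<integral>\<^sup>+x. g x \<partial>lborel)
    = (\<integral>\<^sup>+t. (?L f t + of_nat n * ?L g t) * indicator {0<..<1} t \<partial>lborel)"
    by (simp add: nn_integral_level_sets_unit[symmetric] nn_integral_cmult[symmetric] nn_integral_add[symmetric] distrib_right mult.assoc)
  also have "\<dots> \<le> (\<integral>\<^sup>+t. of_nat (Suc n) * (?L h t * indicator {0<..<1} t) \<partial>lborel)"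
    using key by (intro nn_integral_mono) (auto simp: indicator_def)
  also have "\<dots> = of_nat (Suc n) * (\<integral>\<^sup>+x. min 1 (h x) \<partial>lborel)"
    by (subst nn_integral_cmult) (simp_all add: nn_integral_level_sets_unit)
  also have "\<dots> \<le> of_nat (Suc n) * (\<integral>\<^sup>+x. h x \<partial>lborel)"
    by (intro mult_left_mono nn_integral_mono) auto
  finally show ?thesis .
qed

lemma weighted_am_gm_real:
  fixes a b c :: real
  assumes "0 \<le> a" "0 \<le> b" "a + real n * b \<le> (real n + 1) * c"
  shows "a * b ^ n \<le> c ^ Suc n"
proof (cases "b = 0 \<or> n = 0")
  case True
  have "0 \<le> (real n + 1) * c" using assms by (meson add_nonneg_nonneg mult_nonneg_nonneg of_nat_0_le_iff order_trans)
  then have "0 \<le> c" by (simp add: zero_le_mult_iff)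
  then show ?thesis using True assms by (cases "n = 0") (auto simp: power_0_left)
next
  case False
  then have b: "b > 0" using assms by auto
  \<comment> \<open>\<open>x\<close> is the relative deviation of the weighted mean from
    \<open>b\<close>, so that the mean equals \<open>b * (1 + x)\<close>. Bernoulli's inequality at
    this \<open>x\<close>, multiplied by \<open>b ^ Suc n\<close>, is AM-GM.\<close>
  define x where "x = (a - b) / ((real n + 1) * b)"
  have "0 < (real n + 1) * b" using b by simp
  moreover have "- 1 * ((real n + 1) * b) \<le> a - b"
  proof -
    have "- (real n * b) \<le> a"
      using b assms(1) by (meson mult_nonneg_nonneg neg_le_0_iff_le of_nat_0_le_iff order_trans less_imp_le)
    then show ?thesis by (simp add: algebra_simps)
  qed
  ultimately have x: "x \<ge> -1" unfolding x_def by (simp only: pos_le_divide_eq)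
  have "(real n + 1) * x = (a - b) / b"
    unfolding x_def by (metis add_pos_nonneg mult_divide_mult_cancel_left_if of_nat_0_le_iff times_divide_eq_right
        add.commute less_numeral_extra(1,3))
  then have x1: "(real n + 1) * x = a / b - 1"
    using b by (simp add: diff_divide_distrib)
  have "b * (1 + x) * (real n + 1) = b * (real n + 1) + b * ((real n + 1) * x)"
    by (simp add: algebra_simps)
  also have "\<dots> = a + real n * b"
    unfolding x1 using b by (simp add: algebra_simps)
  finally have m: "b * (1 + x) = (a + real n * b) / (real n + 1)"
    by (simp add: eq_divide_eq)
  have "1 + real (Suc n) * x \<le> (1 + x) ^ Suc n"
    by (rule Bernoulli_inequality[OF x])
  moreover have "1 + real (Suc n) * x = a / b"
    using x1 by (simp add: algebra_simps)
  ultimately have "a / b * b ^ Suc n \<le> (1 + x) ^ Suc n * b ^ Suc n"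
    using b by (intro mult_right_mono) auto
  then have "a * b ^ n \<le> (b * (1 + x)) ^ Suc n"
    using b by (simp add: power_mult_distrib mult_ac)
  also have "\<dots> \<le> c ^ Suc n"
    unfolding m using assms by (intro power_mono) (auto simp: field_simps)
  finally show ?thesis .
qed

lemma weighted_am_gm_ennreal:
  fixes a b c :: ennreal
  assumes "a + of_nat n * b \<le> of_nat (Suc n) * c"
  shows "a * b ^ n \<le> c ^ Suc n"
proof (cases "n = 0")
  case True
  then show ?thesis using assms by simp
next
  case False
  show ?thesis
  proof (cases c)
    case top
    then show ?thesis by (simp add: top_power_ennreal del: power_Suc)
  next
    case (real c')
    then have fin: "of_nat (Suc n) * c < top" by (simp add: ennreal_mult_less_top of_nat_less_top)
    then have "a < top" "of_nat n * b < top" using assms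
      by (meson le_iff_add order_le_less_trans add_increasing2 zero_le order_refl le_add_same_cancel1 add_increasing)+
    then have "b < top" using False by (auto simp: ennreal_mult_less_top)
    obtain a' b' where ab: "a = ennreal a'" "b = ennreal b'" "a' \<ge> 0" "b' \<ge> 0"
      using \<open>a < top\<close> \<open>b < top\<close> by (cases a; cases b) auto
    have "ennreal (a' + real n * b') \<le> ennreal (real (Suc n) * c')"
      using assms ab real by (simp add: ennreal_mult ennreal_of_nat_eq_real_of_nat del: of_nat_Suc)
    then have "a' + real n * b' \<le> (real n + 1) * c'"
      using real by (subst (asm) ennreal_le_iff) (auto simp: algebra_simps)
    from weighted_am_gm_real[OF ab(3,4) this] show ?thesis
      using ab real by (simp add: ennreal_power ennreal_mult[symmetric] del: power_Suc)
  qed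
qed

text \<open>The additive inequality applies to functions of supremum 1, whence the division by
  \<open>M\<close> and \<open>N\<close>; homogeneity restores the factors after AM-GM.\<close>

lemma Prekopa_Leindler_real_bounded:
  fixes F G :: "real \<Rightarrow> real" and H :: "real \<Rightarrow> ennreal" and n :: nat
  assumes [measurable]: "F \<in> borel_measurable borel" "G \<in> borel_measurable borel" "H \<in> borel_measurable borel"
    and F: "\<And>x. 0 \<le> F x" "bdd_above (range F)" and G: "\<And>x. 0 \<le> G x" "bdd_above (range G)"
    and FGH: "\<And>x y. ennreal (F x * G y ^ n) \<le> H ((x + real n * y) / (real n + 1)) ^ Suc n"
    and n: "n > 0"
  shows "(\<integral>\<^sup>+x. F x \<partial>lborel) * (\<integral>\<^sup>+x. G x \<partial>lborel) ^ n \<le> (\<integral>\<^sup>+x. H x \<partial>lborel) ^ Suc n"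
proof -
  define M N where "M = (SUP x. F x)" and "N = (SUP x. G x)"
  have FM: "F x \<le> M" and GN: "G x \<le> N" for x
    unfolding M_def N_def using F G by (auto intro!: cSUP_upper)
  have "0 \<le> M" "0 \<le> N" using FM GN F(1) G(1) order_trans by blast+
  show ?thesis
  proof (cases "M = 0 \<or> N = 0")
    case True
    then have "(\<forall>x. F x = 0) \<or> (\<forall>x. G x = 0)" using FM GN F(1) G(1) by (metis order_antisym)
    then show ?thesis using n by (auto simp: power_0_left)
  next
    case False
    then have MN: "M > 0" "N > 0" using \<open>0 \<le> M\<close> \<open>0 \<le> N\<close> by auto
    \<comment> \<open>The divisor of \<open>H\<close> is forced by the hypothesis: \<open>H\<close>
      scales with the weighted geometric mean of the two suprema.\<close>
    define s where "s = root (Suc n) (M * N ^ n)"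
    have s: "s > 0" "s ^ Suc n = M * N ^ n"
      unfolding s_def using MN by (auto simp del: power_Suc)
    let ?f = "\<lambda>x. ennreal (F x / M)" and ?g = "\<lambda>x. ennreal (G x / N)" and ?h = "\<lambda>x. ennreal (1 / s) * H x"
    have "(\<integral>\<^sup>+x. ?f x \<partial>lborel) + of_nat n * (\<integral>\<^sup>+x. ?g x \<partial>lborel) \<le> of_nat (Suc n) * (\<integral>\<^sup>+x. ?h x \<partial>lborel)"
    proof (rule level_sets_integral_ineq)
      fix t :: real assume t: "0 < t" "t < 1"
      have "t * M < M" "t * N < N" using t MN by auto
      then obtain x y where "t * M < F x" "t * N < G y"
        unfolding M_def N_def
        by (metis (no_types, lifting) UNIV_not_empty F(2) G(2) less_cSUP_iff)
      then have "ennreal t < ?f x" "ennreal t < ?g y"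
        using t MN by (auto simp: ennreal_less_iff field_simps)
      then show "\<exists>x. ennreal t < ?f x" "\<exists>x. ennreal t < ?g x" by blast+
    next
      fix t x y assume t: "0 < t" "t < 1" and "ennreal t < ?f x" "ennreal t < ?g y"
      then have *: "t * M < F x" "t * N < G y"
        using MN by (auto simp: ennreal_less_iff field_simps)
      let ?z = "(x + real n * y) / (real n + 1)"
      have "(t * s) ^ Suc n = (t * M) * (t * N) ^ n"
        using s by (simp add: power_mult_distrib mult_ac)
      also have "\<dots> < F x * G y ^ n"
        using * t MN n less_trans[OF mult_pos_pos *(1)] by (intro mult_strict_mono power_strict_mono) auto
      finally have "ennreal ((t * s) ^ Suc n) < ennreal (F x * G y ^ n)"
        using t s by (subst ennreal_less_iff) (simp_all del: power_Suc)
      also have "\<dots> \<le> H ?z ^ Suc n" by (rule FGH)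
      finally have "ennreal (t * s) ^ Suc n < H ?z ^ Suc n"
        using t s by (simp add: ennreal_power del: power_Suc)
      then have "ennreal (t * s) < H ?z"
        by (meson not_less power_mono zero_le)
      then have "ennreal (1 / s) * ennreal (t * s) < ennreal (1 / s) * H ?z"
        using s by (intro ennreal_mult_strict_left_mono) (auto simp: ennreal_zero_less_divide)
      moreover have "ennreal (1 / s) * ennreal (t * s) = ennreal t"
        using s t by (simp add: ennreal_mult[symmetric])
      ultimately show "ennreal t < ?h ?z" by simp
    qed (use FM GN MN n in \<open>auto simp: ennreal_le_1\<close>)
    then have "(\<integral>\<^sup>+x. ?f x \<partial>lborel) * (\<integral>\<^sup>+x. ?g x \<partial>lborel) ^ n \<le> (\<integral>\<^sup>+x. ?h x \<partial>lborel) ^ Suc n"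
      by (rule weighted_am_gm_ennreal)
    also have "(\<integral>\<^sup>+x. ?h x \<partial>lborel) = ennreal (1 / s) * (\<integral>\<^sup>+x. H x \<partial>lborel)"
      by (rule nn_integral_cmult) simp
    finally have le: "(\<integral>\<^sup>+x. ?f x \<partial>lborel) * (\<integral>\<^sup>+x. ?g x \<partial>lborel) ^ n
        \<le> (ennreal (1 / s) * (\<integral>\<^sup>+x. H x \<partial>lborel)) ^ Suc n" .
    have eqF: "(\<integral>\<^sup>+x. F x \<partial>lborel) = ennreal M * (\<integral>\<^sup>+x. ?f x \<partial>lborel)"
      using MN F by (subst nn_integral_cmult[symmetric]) (auto simp: ennreal_mult[symmetric])
    have eqG: "(\<integral>\<^sup>+x. G x \<partial>lborel) = ennreal N * (\<integral>\<^sup>+x. ?g x \<partial>lborel)"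
      using MN G by (subst nn_integral_cmult[symmetric]) (auto simp: ennreal_mult[symmetric])
    have "(\<integral>\<^sup>+x. F x \<partial>lborel) * (\<integral>\<^sup>+x. G x \<partial>lborel) ^ n
      = ennreal (s ^ Suc n) * ((\<integral>\<^sup>+x. ?f x \<partial>lborel) * (\<integral>\<^sup>+x. ?g x \<partial>lborel) ^ n)"
      unfolding eqF eqG s using MN by (simp add: ennreal_mult ennreal_power power_mult_distrib mult_ac)
    also have "\<dots> \<le> ennreal (s ^ Suc n) * (ennreal (1 / s) * (\<integral>\<^sup>+x. H x \<partial>lborel)) ^ Suc n"
      by (intro mult_left_mono le) simp
    also have "\<dots> = (ennreal s * ennreal (1 / s) * (\<integral>\<^sup>+x. H x \<partial>lborel)) ^ Suc n"
      using s(1) by (simp add: ennreal_power[symmetric] power_mult_distrib mult_ac del: power_Suc)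
    also have "ennreal s * ennreal (1 / s) = 1"
      using s(1) by (simp add: ennreal_mult[symmetric] del: ennreal_1)
    finally show ?thesis by simp
  qed
qed

lemma SUP_mult_incseq_ennreal:
  fixes X Y :: "nat \<Rightarrow> ennreal"
  assumes "incseq X" "incseq Y"
  shows "(SUP k. X k) * (SUP k. Y k) = (SUP k. X k * Y k)"
proof (rule antisym)
  show "(SUP k. X k) * (SUP k. Y k) \<le> (SUP k. X k * Y k)"
  proof (subst SUP_mult_left_ennreal, subst SUP_mult_right_ennreal, intro SUP_least)
    fix i j :: nat
    have "X j * Y i \<le> X (max i j) * Y (max i j)"
      using assms by (intro mult_mono) (auto simp: incseq_def)
    then show "X j * Y i \<le> (SUP k. X k * Y k)"
      by (rule SUP_upper2[OF UNIV_I])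
  qed
  show "(SUP k. X k * Y k) \<le> (SUP k. X k) * (SUP k. Y k)"
    by (intro SUP_least mult_mono SUP_upper) auto
qed

lemma SUP_power_incseq_ennreal:
  fixes X :: "nat \<Rightarrow> ennreal"
  assumes "incseq X"
  shows "(SUP k. X k) ^ n = (SUP k. X k ^ n)"
proof (induction n)
  case (Suc n)
  have "incseq (\<lambda>k. X k ^ n)"
    using assms by (auto simp: incseq_def intro!: power_mono)
  then show ?case
    using assms by (simp add: Suc SUP_mult_incseq_ennreal)
qed simp

text \<open>Truncating \<open>F\<close> and \<open>G\<close> at height \<open>k\<close> keeps the
  hypothesis with the same \<open>H\<close>; monotone convergence then removes the bound.\<close>

lemma Prekopa_Leindler_real:
  fixes F G H :: "real \<Rightarrow> ennreal" and n :: nat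
  assumes [measurable]: "F \<in> borel_measurable borel" "G \<in> borel_measurable borel" "H \<in> borel_measurable borel"
    and FGH: "\<And>x y. F x * G y ^ n \<le> H ((x + real n * y) / (real n + 1)) ^ Suc n"
    and n: "n > 0"
  shows "(\<integral>\<^sup>+x. F x \<partial>lborel) * (\<integral>\<^sup>+x. G x \<partial>lborel) ^ n \<le> (\<integral>\<^sup>+x. H x \<partial>lborel) ^ Suc n"
proof -
  let ?T = "\<lambda>K (k::nat) (x::real). min (K x) (of_nat k) :: ennreal"
  have lim: "(\<integral>\<^sup>+x. K x \<partial>lborel) = (SUP k. \<integral>\<^sup>+x. ?T K k x \<partial>lborel)"
    if [measurable]: "K \<in> borel_measurable borel" for K :: "real \<Rightarrow> ennreal"
  proof -
    have "(SUP k. ?T K k x) = K x" for x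
    proof -
      have "(SUP k. ?T K k x) = inf (K x) (SUP k. of_nat k)"
        by (simp add: inf_min[symmetric] inf_SUP)
      then show ?thesis by (simp add: ennreal_SUP_of_nat_eq_top inf_min)
    qed
    moreover have "incseq (?T K)"
      by (auto simp: incseq_def le_fun_def intro!: order_trans[OF min.cobounded2 of_nat_mono])
    ultimately show ?thesis
      by (subst nn_integral_monotone_convergence_SUP[symmetric]) simp_all
  qed
  have le: "(\<integral>\<^sup>+x. ?T F k x \<partial>lborel) * (\<integral>\<^sup>+x. ?T G k x \<partial>lborel) ^ n \<le> (\<integral>\<^sup>+x. H x \<partial>lborel) ^ Suc n" for k
  proof -
    have fin: "?T K k x < top" for K x by (simp add: min_less_iff_disj of_nat_less_top)
    have real: "ennreal (enn2real (?T K k x)) = ?T K k x" for K x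
      using fin[of K x] by simp
    have bdd: "bdd_above (range (\<lambda>x. enn2real (?T K k x)))" for K
    proof (rule bdd_aboveI2[where M="real k"])
      fix x show "enn2real (?T K k x) \<le> real k"
        by (metis enn2real_mono enn2real_of_nat min.cobounded2 of_nat_less_top)
    qed
    have "(\<integral>\<^sup>+x. ennreal (enn2real (?T F k x)) \<partial>lborel) * (\<integral>\<^sup>+x. ennreal (enn2real (?T G k x)) \<partial>lborel) ^ n
      \<le> (\<integral>\<^sup>+x. H x \<partial>lborel) ^ Suc n"
    proof (rule Prekopa_Leindler_real_bounded)
      fix x y
      have "ennreal (enn2real (?T F k x) * enn2real (?T G k y) ^ n) = ?T F k x * ?T G k y ^ n"
        by (simp add: ennreal_mult ennreal_power[symmetric] real)
      also have "\<dots> \<le> F x * G y ^ n" by (intro mult_mono power_mono) auto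
      also note FGH
      finally show "ennreal (enn2real (?T F k x) * enn2real (?T G k y) ^ n)
        \<le> H ((x + real n * y) / (real n + 1)) ^ Suc n" .
    qed (use bdd n in auto)
    then show ?thesis by (simp only: real)
  qed
  have inc: "incseq (\<lambda>k. \<integral>\<^sup>+x. ?T K k x \<partial>lborel)" for K
    by (auto simp: incseq_def intro!: nn_integral_mono order_trans[OF min.cobounded2 of_nat_mono])
  then have "incseq (\<lambda>k. (\<integral>\<^sup>+x. ?T G k x \<partial>lborel) ^ n)"
    by (auto simp: incseq_def intro!: power_mono)
  then have "(\<integral>\<^sup>+x. F x \<partial>lborel) * (\<integral>\<^sup>+x. G x \<partial>lborel) ^ n
    = (SUP k. (\<integral>\<^sup>+x. ?T F k x \<partial>lborel) * (\<integral>\<^sup>+x. ?T G k x \<partial>lborel) ^ n)"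
    by (simp only: lim[OF assms(1)] lim[OF assms(2)] SUP_power_incseq_ennreal[OF inc] SUP_mult_incseq_ennreal[OF inc])
  also have "\<dots> \<le> (\<integral>\<^sup>+x. H x \<partial>lborel) ^ Suc n"
    by (intro SUP_least le)
  finally show ?thesis .
qed

section \<open>Prekopa--Leindler in finite dimension\<close>

text \<open>Induction on the coordinates: for fixed values \<open>s\<close> and \<open>t\<close> of
  the new one, the conclusion of the induction hypothesis is exactly the one-dimensional hypothesis
  for the partial integrals \<open>?m\<close>.\<close>

lemma Prekopa_Leindler_PiM:
  fixes F G H :: "('i \<Rightarrow> real) \<Rightarrow> ennreal" and n :: nat
  assumes "finite I"
    and "F \<in> borel_measurable (Pi\<^sub>M I (\<lambda>_. lborel))" "G \<in> borel_measurable (Pi\<^sub>M I (\<lambda>_. lborel))"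
      "H \<in> borel_measurable (Pi\<^sub>M I (\<lambda>_. lborel))"
    and "\<And>x y. x \<in> space (Pi\<^sub>M I (\<lambda>_. lborel)) \<Longrightarrow> y \<in> space (Pi\<^sub>M I (\<lambda>_. lborel)) \<Longrightarrow>
      F x * G y ^ n \<le> H (\<lambda>i\<in>I. (x i + real n * y i) / (real n + 1)) ^ Suc n"
    and n: "n > 0"
  shows "(\<integral>\<^sup>+x. F x \<partial>Pi\<^sub>M I (\<lambda>_. lborel)) * (\<integral>\<^sup>+x. G x \<partial>Pi\<^sub>M I (\<lambda>_. lborel)) ^ n
    \<le> (\<integral>\<^sup>+x. H x \<partial>Pi\<^sub>M I (\<lambda>_. lborel)) ^ Suc n"
  using assms(1-5)
proof (induction I arbitrary: F G H rule: finite_induct)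
  case empty
  have "space (Pi\<^sub>M {} (\<lambda>_. lborel :: real measure)) = {\<lambda>_. undefined}" by (simp add: space_PiM)
  then show ?case
    using empty.prems(4)[of "\<lambda>_. undefined" "\<lambda>_. undefined"]
    by (simp add: PiM_empty nn_integral_count_space_finite restrict_def)
next
  case (insert j I)
  interpret P: product_sigma_finite "\<lambda>_::'i. lborel :: real measure" by standard
  let ?L = "\<lambda>_::'i. lborel :: real measure"
  note [measurable] = insert.prems(1-3)
  let ?m = "\<lambda>K s. \<integral>\<^sup>+x. K (x(j := s)) \<partial>Pi\<^sub>M I ?L"
  have ins: "(\<integral>\<^sup>+x. K x \<partial>Pi\<^sub>M (insert j I) ?L) = (\<integral>\<^sup>+s. ?m K s \<partial>lborel)"
    if "K \<in> borel_measurable (Pi\<^sub>M (insert j I) ?L)" for K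
    by (rule P.product_nn_integral_insert_rev[OF insert.hyps(1,2) that])
  have mm: "?m K \<in> borel_measurable borel" if [measurable]: "K \<in> borel_measurable (Pi\<^sub>M (insert j I) ?L)" for K
  proof -
    interpret finite_product_sigma_finite ?L I by standard (rule insert.hyps(1))
    have "?m K \<in> borel_measurable lborel"
      by (rule sigma_finite_measure.borel_measurable_nn_integral[OF P.sigma_finite[OF insert.hyps(1)]]) measurable
    then show ?thesis by simp
  qed
  show ?case
    unfolding ins[OF insert.prems(1)] ins[OF insert.prems(2)] ins[OF insert.prems(3)]
  proof (rule Prekopa_Leindler_real)
    fix s t :: real
    let ?r = "(s + real n * t) / (real n + 1)"
    show "?m F s * ?m G t ^ n \<le> ?m H ?r ^ Suc n"
    proof (rule insert.IH)
      fix x y assume xy: "x \<in> space (Pi\<^sub>M I ?L)" "y \<in> space (Pi\<^sub>M I ?L)"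
      have "x(j := s) \<in> space (Pi\<^sub>M (insert j I) ?L)" "y(j := t) \<in> space (Pi\<^sub>M (insert j I) ?L)"
        using xy by (auto simp: space_PiM PiE_def extensional_def)
      from insert.prems(4)[OF this]
      have "F (x(j := s)) * G (y(j := t)) ^ n
        \<le> H (\<lambda>i\<in>insert j I. ((x(j := s)) i + real n * (y(j := t)) i) / (real n + 1)) ^ Suc n" .
      also have "(\<lambda>i\<in>insert j I. ((x(j := s)) i + real n * (y(j := t)) i) / (real n + 1))
        = (\<lambda>i\<in>I. (x i + real n * y i) / (real n + 1))(j := ?r)"
        using insert.hyps(2) by (auto simp: fun_eq_iff restrict_def)
      finally show "F (x(j := s)) * G (y(j := t)) ^ n
        \<le> H ((\<lambda>i\<in>I. (x i + real n * y i) / (real n + 1))(j := ?r)) ^ Suc n" .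
    qed measurable
  qed (use mm insert.prems n in auto)
qed

text \<open>The weights are \<open>1 / (n + 1)\<close> and \<open>n / (n + 1)\<close>, so that in \<open>ennreal\<close> only natural powers occur;
  the limiting cases needed later are reached as \<open>n\<close> tends to infinity.\<close>

theorem Prekopa_Leindler:
  fixes F G H :: "'a::euclidean_space \<Rightarrow> ennreal" and n :: nat
  assumes [measurable]: "F \<in> borel_measurable borel" "G \<in> borel_measurable borel" "H \<in> borel_measurable borel"
    and FGH: "\<And>x y. F x * G y ^ n \<le> H ((1 / (real n + 1)) *\<^sub>R (x + real n *\<^sub>R y)) ^ Suc n"
    and n: "n > 0"
  shows "(\<integral>\<^sup>+x. F x \<partial>lborel) * (\<integral>\<^sup>+x. G x \<partial>lborel) ^ n \<le> (\<integral>\<^sup>+x. H x \<partial>lborel) ^ Suc n"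
proof -
  let ?s = "\<lambda>f::'a \<Rightarrow> real. \<Sum>b\<in>Basis. f b *\<^sub>R b"
  have eq: "(\<integral>\<^sup>+x. K x \<partial>lborel) = (\<integral>\<^sup>+f. K (?s f) \<partial>(Pi\<^sub>M Basis (\<lambda>_. lborel)))"
    if [measurable]: "K \<in> borel_measurable borel" for K :: "'a \<Rightarrow> ennreal"
    by (subst lborel_eq, subst nn_integral_distr) simp_all
  have "?s (\<lambda>b\<in>Basis. (x b + real n * y b) / (real n + 1)) = (1 / (real n + 1)) *\<^sub>R (?s x + real n *\<^sub>R ?s y)" for x y
    unfolding scaleR_sum_right sum.distrib[symmetric]
  proof (rule sum.cong)
    fix b :: 'a assume "b \<in> Basis"
    then show "(\<lambda>b\<in>Basis. (x b + real n * y b) / (real n + 1)) b *\<^sub>R b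
      = (1 / (real n + 1)) *\<^sub>R (x b *\<^sub>R b + real n *\<^sub>R y b *\<^sub>R b)"
      by (simp add: scaleR_add_left[symmetric])
  qed simp
  then show ?thesis
    unfolding eq[OF assms(1)] eq[OF assms(2)] eq[OF assms(3)]
    using n FGH by (intro Prekopa_Leindler_PiM) simp_all
qed

lemma Prekopa_Leindler_integral:
  fixes F G H :: "'a::euclidean_space \<Rightarrow> real" and n :: nat
  assumes "integrable lborel F" "integrable lborel G" "integrable lborel H"
    and nonneg: "\<And>x. 0 \<le> F x" "\<And>x. 0 \<le> G x" "\<And>x. 0 \<le> H x"
    and FGH: "\<And>x y. F x * G y ^ n \<le> H ((1 / (real n + 1)) *\<^sub>R (x + real n *\<^sub>R y)) ^ Suc n"
    and n: "n > 0"
  shows "(\<integral>x. F x \<partial>lborel) * (\<integral>x. G x \<partial>lborel) ^ n \<le> (\<integral>x. H x \<partial>lborel) ^ Suc n"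
proof -
  note [measurable] = assms(1-3)[THEN borel_measurable_integrable]
  have "(\<integral>\<^sup>+x. F x \<partial>lborel) * (\<integral>\<^sup>+x. G x \<partial>lborel) ^ n \<le> (\<integral>\<^sup>+x. H x \<partial>lborel) ^ Suc n"
  proof (rule Prekopa_Leindler)
    fix x y
    show "ennreal (F x) * ennreal (G y) ^ n \<le> ennreal (H ((1 / (real n + 1)) *\<^sub>R (x + real n *\<^sub>R y))) ^ Suc n"
      using FGH[of x y] nonneg by (simp add: ennreal_power ennreal_mult[symmetric] ennreal_leI del: power_Suc)
  qed (use n in auto)
  then show ?thesis
    using assms(1-3) nonneg
    by (simp add: nn_integral_eq_integral ennreal_power ennreal_mult[symmetric] Bochner_Integration.integral_nonneg del: power_Suc)
qed

section \<open>The conditional kernels\<close>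

text \<open>The last term is the uniform convexity of the squared norm; kept as an exact defect, it
  later pays for the transport cost.\<close>

lemma norm_sq_weighted_mean:
  fixes A B :: "'a::real_inner"
  shows "(real n + 1) * (norm ((1 / (real n + 1)) *\<^sub>R (A + real n *\<^sub>R B)))\<^sup>2
    = (norm A)\<^sup>2 + real n * (norm B)\<^sup>2 - real n / (real n + 1) * (norm (A - B))\<^sup>2"
proof -
  have nz: "real n + 1 \<noteq> 0" by (metis of_nat_Suc of_nat_eq_0_iff nat.distinct(1) add.commute)
  have "(norm (A + real n *\<^sub>R B))\<^sup>2 = (real n + 1) * ((norm A)\<^sup>2 + real n * (norm B)\<^sup>2) - real n * (norm (A - B))\<^sup>2"
    by (simp add: power2_norm_eq_inner inner_simps inner_commute algebra_simps)
  moreover have "(norm ((1 / (real n + 1)) *\<^sub>R (A + real n *\<^sub>R B)))\<^sup>2 = (norm (A + real n *\<^sub>R B))\<^sup>2 / (real n + 1)\<^sup>2"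
    unfolding norm_scaleR by (simp add: power_divide)
  ultimately have "(real n + 1) * (norm ((1 / (real n + 1)) *\<^sub>R (A + real n *\<^sub>R B)))\<^sup>2
    = ((real n + 1) * ((norm A)\<^sup>2 + real n * (norm B)\<^sup>2) - real n * (norm (A - B))\<^sup>2) / (real n + 1)"
    using nz by (simp add: power2_eq_square)
  also have "\<dots> = (norm A)\<^sup>2 + real n * (norm B)\<^sup>2 - real n / (real n + 1) * (norm (A - B))\<^sup>2"
    using nz by (simp add: diff_divide_distrib)
  finally show ?thesis .
qed

lemma le_if_le_add_inverse_nat:
  fixes a c d :: real
  assumes "\<And>n::nat. n > 0 \<Longrightarrow> a \<le> c + d / real n"
  shows "a \<le> c"
proof (rule LIMSEQ_le_const)
  show "(\<lambda>n. c + d / real n) \<longlonglongrightarrow> c"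
    using tendsto_add[OF tendsto_const lim_const_over_n[of d], of c] by simp
  show "\<exists>N. \<forall>n\<ge>N. a \<le> c + d / real n" using assms by (auto intro!: exI[of _ 1])
qed

text \<open>Jensen's inequality, by integrating the tangent of \<open>exp\<close> at the
  mean.\<close>

lemma (in prob_space) exp_expectation_le:
  fixes X :: "'a \<Rightarrow> real"
  assumes X: "integrable M X" "integrable M (\<lambda>x. exp (X x))"
  shows "exp (expectation X) \<le> expectation (\<lambda>x. exp (X x))"
proof -
  let ?m = "expectation X"
  have "expectation (\<lambda>x. exp ?m * (1 + (X x - ?m))) \<le> expectation (\<lambda>x. exp (X x))"
  proof (rule integral_mono)
    fix x
    have "exp ?m * (1 + (X x - ?m)) \<le> exp ?m * exp (X x - ?m)"
      by (intro mult_left_mono exp_ge_add_one_self) simp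
    then show "exp ?m * (1 + (X x - ?m)) \<le> exp (X x)" by (simp add: exp_diff)
  qed (use X in auto)
  moreover have "expectation (\<lambda>x. exp ?m * (1 + (X x - ?m))) = exp ?m"
    using X by (simp add: prob_space)
  ultimately show ?thesis by simp
qed

lemma (in prob_space) expectation_le_ln:
  fixes p :: "'a \<Rightarrow> real"
  assumes "integrable M p" "\<And>x. 0 < p x" "integrable M (\<lambda>x. ln (p x))"
  shows "expectation (\<lambda>x. ln (p x)) \<le> ln (expectation p)"
proof -
  have "exp (expectation (\<lambda>x. ln (p x))) \<le> expectation p"
    using exp_expectation_le[OF assms(3)] assms by simp
  then show ?thesis by (metis exp_gt_zero ln_exp ln_le_cancel_iff less_le_trans)
qed

lemma convex_on_UNIV_borel_measurable:
  fixes h :: "'a::euclidean_space \<Rightarrow> real"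
  assumes "convex_on UNIV h"
  shows "h \<in> borel_measurable borel"
  by (intro borel_measurable_continuous_onI convex_on_continuous assms) simp

section \<open>The kernel and its change of base point\<close>

text \<open>A single potential \<open>h\<close> serves both half-steps, as \<open>g\<close> or as
  \<open>f\<close>. Integrability is demanded at every \<open>x\<close>, since the kernel must be a
  probability measure everywhere: a Bochner integral that does not exist is 0, and the density of
  \<open>gibbs_cond\<close> would then be 0 as well.\<close>

locale proximal_kernel =
  fixes \<eta> :: real and h :: "'a::euclidean_space \<Rightarrow> real"
  assumes eta_pos: "\<eta> > 0"
    and h_convex: "convex_on UNIV h"
    and weight_integrable: "\<And>x. integrable lborel (\<lambda>y. exp (- h y - (norm (x - y))\<^sup>2 / (2 * \<eta>)))"
begin

definition W :: "'a \<Rightarrow> 'a \<Rightarrow> real" where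
  "W x y = exp (- h y - (norm (x - y))\<^sup>2 / (2 * \<eta>))"

definition Z :: "'a \<Rightarrow> real" where
  "Z x = (\<integral>y. W x y \<partial>lborel)"

abbreviation Q :: "'a \<Rightarrow> 'a measure" where
  "Q \<equiv> gibbs_cond \<eta> h"

lemma h_measurable [measurable]: "h \<in> borel_measurable borel"
  by (rule convex_on_UNIV_borel_measurable[OF h_convex])

lemma W_measurable [measurable]: "case_prod W \<in> borel_measurable (borel \<Otimes>\<^sub>M borel)" "W x \<in> borel_measurable borel"
  unfolding W_def[abs_def] by measurable

lemma W_pos: "0 < W x y"
  by (simp add: W_def)

lemma W_integrable: "integrable lborel (W x)"
  using weight_integrable[of x] by (simp add: W_def[abs_def])

lemma Z_pos: "0 < Z x"
proof -
  have "Z x \<noteq> 0"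
  proof
    assume "Z x = 0"
    then have "AE y in lborel. W x y = 0"
      using W_integrable W_pos unfolding Z_def by (subst (asm) integral_nonneg_eq_0_iff_AE) (auto intro!: AE_I2 less_imp_le)
    then have "AE y in (lborel :: 'a measure). False"
      by eventually_elim (use W_pos in \<open>metis less_irrefl\<close>)
    then show False by (simp add: AE_iff_null null_sets_def)
  qed
  moreover have "0 \<le> Z x" unfolding Z_def by (intro Bochner_Integration.integral_nonneg less_imp_le W_pos)
  ultimately show ?thesis by simp
qed

lemma Z_measurable [measurable]: "Z \<in> borel_measurable borel"
  unfolding Z_def[abs_def] by measurable

lemma Q_eq: "Q x = density lborel (\<lambda>y. ennreal (W x y / Z x))"
  by (simp add: gibbs_cond_def W_def[abs_def] Z_def)

lemma sets_Q [simp, measurable_cong]: "sets (Q x) = sets borel"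
  by (simp add: Q_eq)

lemma space_Q [simp]: "space (Q x) = UNIV"
  by (simp add: Q_eq)

lemma prob_space_Q: "prob_space (Q x)"
proof
  have "emeasure (Q x) (space (Q x)) = (\<integral>\<^sup>+y. ennreal (W x y / Z x) \<partial>lborel)"
    by (simp add: Q_eq emeasure_density)
  also have "\<dots> = ennreal (\<integral>y. W x y / Z x \<partial>lborel)"
    using W_integrable W_pos Z_pos by (intro nn_integral_eq_integral) (auto intro!: less_imp_le)
  also have "(\<integral>y. W x y / Z x \<partial>lborel) = 1"
    using Z_pos[of x] by (simp add: Z_def)
  finally show "emeasure (Q x) (space (Q x)) = 1" by simp
qed

lemma integrable_Q_iff:
  fixes \<phi> :: "'a \<Rightarrow> real"
  assumes [measurable]: "\<phi> \<in> borel_measurable borel"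
  shows "integrable (Q x) \<phi> \<longleftrightarrow> integrable lborel (\<lambda>y. W x y * \<phi> y)"
proof -
  have "integrable (Q x) \<phi> \<longleftrightarrow> integrable lborel (\<lambda>y. (W x y / Z x) *\<^sub>R \<phi> y)"
    unfolding Q_eq using W_pos Z_pos by (intro integrable_density) (auto intro!: AE_I2 less_imp_le)
  also have "(\<lambda>y. (W x y / Z x) *\<^sub>R \<phi> y) = (\<lambda>y. (1 / Z x) * (W x y * \<phi> y))"
    by simp
  also have "integrable lborel \<dots> \<longleftrightarrow> integrable lborel (\<lambda>y. W x y * \<phi> y)"
    using Z_pos[of x] by (subst integrable_mult_left_iff) simp
  finally show ?thesis .
qed

lemma integral_Q:
  fixes \<phi> :: "'a \<Rightarrow> real"
  assumes [measurable]: "\<phi> \<in> borel_measurable borel"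
  shows "(\<integral>y. \<phi> y \<partial>Q x) = (\<integral>y. W x y * \<phi> y \<partial>lborel) / Z x"
proof -
  have "(\<integral>y. \<phi> y \<partial>Q x) = (\<integral>y. (W x y / Z x) *\<^sub>R \<phi> y \<partial>lborel)"
    unfolding Q_eq using W_pos Z_pos by (intro integral_density) (auto intro!: AE_I2 less_imp_le)
  also have "\<dots> = (\<integral>y. W x y * \<phi> y / Z x \<partial>lborel)"
    by simp
  finally show ?thesis by simp
qed

lemma integrable_Q_bounded:
  fixes \<phi> :: "'a \<Rightarrow> real"
  assumes [measurable]: "\<phi> \<in> borel_measurable borel" and "\<And>y. \<bar>\<phi> y\<bar> \<le> B"
  shows "integrable (Q x) \<phi>"
proof -
  interpret prob_space "Q x" by (rule prob_space_Q)
  show ?thesis using assms by (intro integrable_const_bound[where B=B]) simp_all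
qed

text \<open>Expanding the square, a move of the base point multiplies the weight by the exponential
  of an affine function of \<open>y\<close>: the kernels form an exponential family with normaliser
  \<open>Z\<close>.\<close>

lemma W_shift: "W (x + v) y = W x y * exp ((v \<bullet> (y - x)) / \<eta> - (norm v)\<^sup>2 / (2 * \<eta>))"
proof -
  have "(norm (x + v - y))\<^sup>2 = (norm (x - y))\<^sup>2 - 2 * (v \<bullet> (y - x)) + (norm v)\<^sup>2"
    by (simp add: power2_norm_eq_inner inner_simps inner_commute algebra_simps)
  then have "- h y - (norm (x + v - y))\<^sup>2 / (2 * \<eta>)
    = (- h y - (norm (x - y))\<^sup>2 / (2 * \<eta>)) + ((v \<bullet> (y - x)) / \<eta> - (norm v)\<^sup>2 / (2 * \<eta>))"
    by (simp add: add_divide_distrib diff_divide_distrib)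
  then show ?thesis unfolding W_def by (simp add: exp_add[symmetric])
qed

text \<open>The tilted weight is, up to a constant, the weight at \<open>x + v\<close>; hence all
  exponential moments exist.\<close>

lemma integrable_Q_exp_linear: "integrable (Q x) (\<lambda>y. exp ((v \<bullet> (y - x)) / \<eta>))"
proof -
  have "integrable lborel (\<lambda>y. exp ((norm v)\<^sup>2 / (2 * \<eta>)) * W (x + v) y)"
    using W_integrable by simp
  also have "(\<lambda>y. exp ((norm v)\<^sup>2 / (2 * \<eta>)) * W (x + v) y) = (\<lambda>y. W x y * exp ((v \<bullet> (y - x)) / \<eta>))"
    by (simp add: W_shift exp_diff)
  finally show ?thesis by (subst integrable_Q_iff) auto
qed

lemma integrable_Q_linear: "integrable (Q x) (\<lambda>y. (v \<bullet> (y - x)) / \<eta>)"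
proof (rule Bochner_Integration.integrable_bound)
  show "integrable (Q x) (\<lambda>y. exp ((v \<bullet> (y - x)) / \<eta>) + exp (((- v) \<bullet> (y - x)) / \<eta>))"
    by (intro Bochner_Integration.integrable_add integrable_Q_exp_linear)
  show "AE y in Q x. norm ((v \<bullet> (y - x)) / \<eta>) \<le> norm (exp ((v \<bullet> (y - x)) / \<eta>) + exp (((- v) \<bullet> (y - x)) / \<eta>))"
  proof (rule AE_I2)
    fix y
    have abs_le: "\<bar>t\<bar> \<le> exp t + exp (- t)" for t :: real
      using exp_ge_add_one_self[of t] exp_ge_add_one_self[of "- t"] exp_gt_zero[of t] exp_gt_zero[of "- t"]
      by linarith
    show "norm ((v \<bullet> (y - x)) / \<eta>) \<le> norm (exp ((v \<bullet> (y - x)) / \<eta>) + exp (((- v) \<bullet> (y - x)) / \<eta>))"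
      using abs_le[of "(v \<bullet> (y - x)) / \<eta>"] by simp
  qed
qed measurable

lemma integral_Q_shift:
  fixes \<phi> :: "'a \<Rightarrow> real"
  assumes [measurable]: "\<phi> \<in> borel_measurable borel"
  shows "(\<integral>y. \<phi> y \<partial>Q (x + v))
    = Z x / Z (x + v) * (\<integral>y. \<phi> y * exp ((v \<bullet> (y - x)) / \<eta> - (norm v)\<^sup>2 / (2 * \<eta>)) \<partial>Q x)"
  using Z_pos[of x] by (simp add: integral_Q W_shift mult_ac)

section \<open>Log-concavity and the inequalities for one kernel\<close>

text \<open>Convexity of \<open>h\<close> together with the norm identity for \<open>p - y\<close>
  and \<open>q - y'\<close>. The exponential factor is the surplus of the quadratic part: it is
  dropped for the partition function and used in full for the transport inequality.\<close>

lemma W_joint_log_concave: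
  "W p y * W q y' ^ n * exp (real n / (real n + 1) * ((norm ((p - y) - (q - y')))\<^sup>2 / (2 * \<eta>)))
    \<le> W ((1 / (real n + 1)) *\<^sub>R (p + real n *\<^sub>R q)) ((1 / (real n + 1)) *\<^sub>R (y + real n *\<^sub>R y')) ^ Suc n"
proof -
  let ?c = "1 / (real n + 1)"
  let ?x = "?c *\<^sub>R (p + real n *\<^sub>R q)" and ?y = "?c *\<^sub>R (y + real n *\<^sub>R y')"
  have "h ?y \<le> ?c * h y + (real n * ?c) * h y'"
    using convex_onD[OF h_convex, of "real n * ?c" y y'] by (simp add: field_simps)
  then have "(real n + 1) * h ?y \<le> (real n + 1) * (?c * h y + (real n * ?c) * h y')"
    by (intro mult_left_mono) auto
  also have "\<dots> = ((real n + 1) * ?c) * h y + (real n * ((real n + 1) * ?c)) * h y'"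
    by (simp only: algebra_simps)
  also have "(real n + 1) * ?c = 1" by (simp add: add_nonneg_eq_0_iff)
  finally have 1: "(real n + 1) * h ?y \<le> h y + real n * h y'" by simp
  have "?x - ?y = ?c *\<^sub>R ((p - y) + real n *\<^sub>R (q - y'))"
    by (simp add: algebra_simps)
  then have 2: "(real n + 1) * (norm (?x - ?y))\<^sup>2
    = (norm (p - y))\<^sup>2 + real n * (norm (q - y'))\<^sup>2 - real n / (real n + 1) * (norm ((p - y) - (q - y')))\<^sup>2"
    by (simp only: norm_sq_weighted_mean)
  have "(- h y - (norm (p - y))\<^sup>2 / (2 * \<eta>)) + real n * (- h y' - (norm (q - y'))\<^sup>2 / (2 * \<eta>))
      + real n / (real n + 1) * ((norm ((p - y) - (q - y')))\<^sup>2 / (2 * \<eta>))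
    = - (h y + real n * h y') - ((norm (p - y))\<^sup>2 + real n * (norm (q - y'))\<^sup>2
        - real n / (real n + 1) * (norm ((p - y) - (q - y')))\<^sup>2) / (2 * \<eta>)"
    by (simp add: algebra_simps add_divide_distrib diff_divide_distrib)
  also have "\<dots> \<le> - ((real n + 1) * h ?y) - ((real n + 1) * (norm (?x - ?y))\<^sup>2) / (2 * \<eta>)"
    unfolding 2[symmetric] using 1 by simp
  also have "\<dots> = real (Suc n) * (- h ?y - (norm (?x - ?y))\<^sup>2 / (2 * \<eta>))"
    by (simp add: algebra_simps add_divide_distrib)
  finally show ?thesis
    unfolding W_def by (simp add: exp_of_nat_mult[symmetric] exp_add[symmetric] del: of_nat_Suc power_Suc)
qed

text \<open>Prekopa--Leindler in the variable \<open>y\<close>; the surplus factor of the joint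
  inequality is at least 1.\<close>

lemma Z_log_concave:
  assumes "n > 0"
  shows "Z p * Z q ^ n \<le> Z ((1 / (real n + 1)) *\<^sub>R (p + real n *\<^sub>R q)) ^ Suc n"
  unfolding Z_def
proof (rule Prekopa_Leindler_integral)
  fix y y'
  let ?r = "real n / (real n + 1) * ((norm ((p - y) - (q - y')))\<^sup>2 / (2 * \<eta>))"
  have "W p y * W q y' ^ n * 1 \<le> W p y * W q y' ^ n * exp ?r"
    using eta_pos W_pos by (intro mult_left_mono) (auto intro!: less_imp_le)
  also note W_joint_log_concave
  finally show "W p y * W q y' ^ n
    \<le> W ((1 / (real n + 1)) *\<^sub>R (p + real n *\<^sub>R q)) ((1 / (real n + 1)) *\<^sub>R (y + real n *\<^sub>R y')) ^ Suc n"
    by simp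
qed (use assms W_integrable W_pos in \<open>auto intro: less_imp_le\<close>)

text \<open>The gradient of \<open>ln Z\<close> at \<open>x\<close> is never formed: it is replaced by the difference quotient of step
  \<open>1 / n\<close> opposite to \<open>x'\<close>, which Jensen's inequality bounds by the mean of \<open>Q x\<close>.\<close>

lemma log_Harnack_kernel:
  fixes b :: "'a \<Rightarrow> real"
  assumes b [measurable]: "b \<in> borel_measurable borel" and bdd: "\<And>y. \<bar>b y\<bar> \<le> B"
  shows "(\<integral>y. b y \<partial>Q x) - ln (\<integral>y. exp (b y) \<partial>Q x') \<le> (norm (x - x'))\<^sup>2 / (2 * \<eta>)"
proof -
  interpret P: prob_space "Q x" by (rule prob_space_Q)
  define v where "v = x' - x"
  define c where "c = (norm v)\<^sup>2 / (2 * \<eta>)"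
  define l where "l = (\<lambda>y. (v \<bullet> (y - x)) / \<eta>)"
  define T where "T = (\<integral>y. l y \<partial>Q x)"
  have [measurable]: "l \<in> borel_measurable borel" unfolding l_def by measurable
  have ib: "integrable (Q x) b" by (rule integrable_Q_bounded[OF b bdd])
  have il: "integrable (Q x) l" unfolding l_def by (rule integrable_Q_linear)
  have x': "x' = x + v" by (simp add: v_def)
  \<comment> \<open>\<open>l y - c\<close> is the log-density of \<open>Q x'\<close> relative to
    \<open>Q x\<close> up to the ratio of partition functions, so the right side becomes an integral
    over \<open>Q x'\<close>. The resulting bound in \<open>A'\<close> is the relative entropy of
    \<open>Q x\<close> with respect to \<open>Q x'\<close>.\<close>
  have "exp (\<integral>y. b y + l y - c \<partial>Q x) \<le> (\<integral>y. exp (b y + l y - c) \<partial>Q x)"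
  proof (rule P.exp_expectation_le)
    show "integrable (Q x) (\<lambda>y. exp (b y + l y - c))"
    proof (rule Bochner_Integration.integrable_bound)
      show "integrable (Q x) (\<lambda>y. exp (B - c) * exp (l y))"
        using integrable_Q_exp_linear[of x v] unfolding l_def by simp
      show "AE y in Q x. norm (exp (b y + l y - c)) \<le> norm (exp (B - c) * exp (l y))"
        using bdd by (auto simp: exp_add[symmetric] abs_le_iff algebra_simps)
    qed measurable
  qed (use ib il in auto)
  also have "\<dots> = (\<integral>y. exp (b y) * exp (l y - c) \<partial>Q x)"
    by (simp add: exp_add[symmetric] algebra_simps)
  also have "\<dots> = Z x' / Z x * (\<integral>y. exp (b y) \<partial>Q x')"
    unfolding x' using Z_pos[of x] Z_pos[of "x + v"]
    by (subst integral_Q_shift) (simp_all add: l_def c_def)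
  also have "(\<integral>y. b y + l y - c \<partial>Q x) = (\<integral>y. b y \<partial>Q x) + T - c"
    using ib il P.prob_space by (simp add: T_def)
  finally have A: "exp ((\<integral>y. b y \<partial>Q x) + T - c) \<le> Z x' / Z x * (\<integral>y. exp (b y) \<partial>Q x')" .
  then have pos: "0 < (\<integral>y. exp (b y) \<partial>Q x')"
    using Z_pos[of x] Z_pos[of x'] by (metis exp_gt_zero less_le_trans zero_less_mult_pos divide_pos_pos)
  have "(\<integral>y. b y \<partial>Q x) + T - c \<le> ln (Z x' / Z x * (\<integral>y. exp (b y) \<partial>Q x'))"
    using A pos Z_pos by (subst ln_ge_iff) auto
  also have "\<dots> = ln (Z x') - ln (Z x) + ln (\<integral>y. exp (b y) \<partial>Q x')"
    using pos Z_pos[of x] Z_pos[of x'] by (simp add: ln_mult ln_div)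
  finally have A': "(\<integral>y. b y \<partial>Q x) - ln (\<integral>y. exp (b y) \<partial>Q x') \<le> ln (Z x') - ln (Z x) + c - T" by simp
  \<comment> \<open>This cancels the mean \<open>T\<close> in \<open>A'\<close>, with an error that
    vanishes as \<open>n\<close> grows.\<close>
  have B: "ln (Z x') - ln (Z x) \<le> T + c / real n" if n: "n > 0" for n :: nat
  proof -
    define w where "w = (- 1 / real n) *\<^sub>R v"
    have lw: "(w \<bullet> (y - x)) / \<eta> - (norm w)\<^sup>2 / (2 * \<eta>) = - l y / real n - c / (real n)\<^sup>2" for y
      unfolding w_def l_def c_def by (simp add: power_divide mult_ac)
    have "exp (\<integral>y. - l y / real n - c / (real n)\<^sup>2 \<partial>Q x) \<le> (\<integral>y. exp (- l y / real n - c / (real n)\<^sup>2) \<partial>Q x)"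
    proof (rule P.exp_expectation_le)
      have "integrable (Q x) (\<lambda>y. exp ((w \<bullet> (y - x)) / \<eta>) / exp ((norm w)\<^sup>2 / (2 * \<eta>)))"
        by (rule integrable_divide_zero[OF integrable_Q_exp_linear])
      then show "integrable (Q x) (\<lambda>y. exp (- l y / real n - c / (real n)\<^sup>2))"
        unfolding lw[symmetric] exp_diff .
    qed (use il in auto)
    also have "(\<integral>y. - l y / real n - c / (real n)\<^sup>2 \<partial>Q x) = - T / real n - c / (real n)\<^sup>2"
      using il P.prob_space by (simp add: T_def)
    also have "(\<integral>y. exp (- l y / real n - c / (real n)\<^sup>2) \<partial>Q x) = Z (x + w) / Z x"
    proof -
      interpret P': prob_space "Q (x + w)" by (rule prob_space_Q)
      have "1 = Z x / Z (x + w) * (\<integral>y. exp (- l y / real n - c / (real n)\<^sup>2) \<partial>Q x)"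
        using integral_Q_shift[of "\<lambda>_. 1" x w] P'.prob_space Z_pos[of x] Z_pos[of "x + w"]
        by (simp only: lw space_Q lebesgue_integral_const mult_1 scaleR_one) auto
      moreover have "1 = s / t * E \<Longrightarrow> 0 < s \<Longrightarrow> 0 < t \<Longrightarrow> E = t / s" for s t E :: real
        by (simp add: field_simps)
      ultimately show ?thesis using Z_pos by blast
    qed
    finally have "- T / real n - c / (real n)\<^sup>2 \<le> ln (Z (x + w) / Z x)"
      using Z_pos by (subst ln_ge_iff) auto
    then have lower: "- T / real n - c / (real n)\<^sup>2 \<le> ln (Z (x + w)) - ln (Z x)"
      using Z_pos[of x] Z_pos[of "x + w"] by (simp add: ln_div)
    \<comment> \<open>The step length makes \<open>x\<close> the weighted mean of \<open>x'\<close>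
      and \<open>x + w\<close>, the form in which log-concavity of \<open>Z\<close> is
      available.\<close>
    have "(1 / (real n + 1)) *\<^sub>R (x' + real n *\<^sub>R (x + w)) = (1 / (real n + 1)) *\<^sub>R ((real n + 1) *\<^sub>R x)"
      using n by (simp add: w_def v_def algebra_simps)
    also have "\<dots> = x" by (simp add: add_nonneg_eq_0_iff)
    finally have "Z x' * Z (x + w) ^ n \<le> Z x ^ Suc n"
      using Z_log_concave[OF n, of x' "x + w"] by (simp only:)
    then have "ln (Z x' * Z (x + w) ^ n) \<le> ln (Z x ^ Suc n)"
      using Z_pos by (subst ln_le_cancel_iff) auto
    then have "ln (Z x') + real n * ln (Z (x + w)) \<le> (real n + 1) * ln (Z x)"
      using Z_pos[of x] Z_pos[of x'] Z_pos[of "x + w"] by (simp add: ln_mult ln_realpow algebra_simps)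
    then have "ln (Z x') - ln (Z x) \<le> real n * (- (ln (Z (x + w)) - ln (Z x)))"
      by (simp add: algebra_simps)
    also have "\<dots> \<le> real n * (T / real n + c / (real n)\<^sup>2)"
      using lower by (intro mult_left_mono) auto
    also have "\<dots> = T + c / real n"
      using n by (simp add: field_simps power2_eq_square)
    finally show ?thesis .
  qed
  have "(\<integral>y. b y \<partial>Q x) - ln (\<integral>y. exp (b y) \<partial>Q x') \<le> c"
  proof (rule le_if_le_add_inverse_nat)
    fix n :: nat assume "n > 0"
    from A' B[OF this] show "(\<integral>y. b y \<partial>Q x) - ln (\<integral>y. exp (b y) \<partial>Q x') \<le> c + c / real n"
      by linarith
  qed
  then show ?thesis by (simp add: c_def v_def norm_minus_commute)
qed

text \<open>Talagrand's transport inequality for \<open>Q x\<close> in dual form, as \<open>n\<close> tends to infinity.\<close>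

lemma transport_entropy_dual:
  fixes a b :: "'a \<Rightarrow> real"
  assumes [measurable]: "a \<in> borel_measurable borel" "b \<in> borel_measurable borel"
    and bdd: "\<And>y. \<bar>a y\<bar> \<le> B" "\<And>y. \<bar>b y\<bar> \<le> B"
    and ab: "\<And>y y'. a y - b y' \<le> (norm (y - y'))\<^sup>2 / (2 * \<eta>)"
    and n: "n > 0"
  shows "ln (\<integral>y. exp (real n / (real n + 1) * a y) \<partial>Q x) \<le> real n / (real n + 1) * (\<integral>y. b y \<partial>Q x)"
proof -
  interpret P: prob_space "Q x" by (rule prob_space_Q)
  let ?r = "real n / (real n + 1)"
  have iexp: "integrable (Q x) (\<lambda>y. exp (t * \<phi> y))"
    if [measurable]: "\<phi> \<in> borel_measurable borel" and "\<And>y. \<bar>\<phi> y\<bar> \<le> B" for t and \<phi> :: "'a \<Rightarrow> real"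
  proof (rule integrable_Q_bounded)
    fix y
    have "t * \<phi> y \<le> \<bar>t\<bar> * B" 
      using order_trans[OF abs_ge_self[of "t * \<phi> y"], of "\<bar>t\<bar> * B"] that(2)[of y]
      by (simp add: abs_mult mult_left_mono)
    then show "\<bar>exp (t * \<phi> y)\<bar> \<le> exp (\<bar>t\<bar> * B)" by simp
  qed measurable
  \<comment> \<open>The \<open>n\<close>-th power of the second factor gives \<open>b\<close> the
    same coefficient \<open>n / (n + 1)\<close> as \<open>a\<close>. The difference
    \<open>a y - b y'\<close> is then bounded by the cost, which the surplus in
    \<open>W_joint_log_concave\<close> at equal base points absorbs exactly.\<close>
  let ?F = "\<lambda>y. W x y * exp (?r * a y)" and ?G = "\<lambda>y. W x y * exp (- (1 / (real n + 1)) * b y)"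
  have "(\<integral>y. ?F y \<partial>lborel) * (\<integral>y. ?G y \<partial>lborel) ^ n \<le> (\<integral>y. W x y \<partial>lborel) ^ Suc n"
  proof (rule Prekopa_Leindler_integral)
    show "integrable lborel ?F" "integrable lborel ?G"
      by (rule integrable_Q_iff[THEN iffD1, OF _ iexp]; use bdd in simp)+
    fix y y' :: 'a
    let ?z = "(1 / (real n + 1)) *\<^sub>R (y + real n *\<^sub>R y')"
    have "?F y * ?G y' ^ n = W x y * W x y' ^ n * exp (?r * (a y - b y'))"
    proof -
      have "real n * (- (1 / (real n + 1)) * b y') + ?r * a y = ?r * (a y - b y')"
        by (simp add: right_diff_distrib)
      then have "exp (?r * a y) * exp (- (1 / (real n + 1)) * b y') ^ n = exp (?r * (a y - b y'))"
        by (simp only: exp_of_nat_mult[symmetric] exp_add[symmetric] add.commute)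
      then show ?thesis by (simp only: power_mult_distrib mult_ac)
    qed
    also have "\<dots> \<le> W x y * W x y' ^ n * exp (?r * ((norm ((x - y) - (x - y')))\<^sup>2 / (2 * \<eta>)))"
    proof (rule mult_left_mono)
      have "?r * (a y - b y') \<le> ?r * ((norm (y - y'))\<^sup>2 / (2 * \<eta>))"
        by (intro mult_left_mono ab) simp
      then show "exp (?r * (a y - b y')) \<le> exp (?r * ((norm ((x - y) - (x - y')))\<^sup>2 / (2 * \<eta>)))"
        by (simp add: norm_minus_commute)
    qed (use W_pos in \<open>simp add: less_imp_le\<close>)
    also have "\<dots> \<le> W ((1 / (real n + 1)) *\<^sub>R (x + real n *\<^sub>R x)) ?z ^ Suc n"
      by (rule W_joint_log_concave)
    also have "(1 / (real n + 1)) *\<^sub>R (x + real n *\<^sub>R x) = (1 / (real n + 1)) *\<^sub>R ((real n + 1) *\<^sub>R x)"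
      by (simp add: algebra_simps)
    also have "\<dots> = x" by (simp add: add_nonneg_eq_0_iff)
    finally show "?F y * ?G y' ^ n \<le> W x ?z ^ Suc n" .
  qed (use W_integrable W_pos n in \<open>auto intro!: less_imp_le\<close>)
  then have "(Z x * (\<integral>y. exp (?r * a y) \<partial>Q x)) * (Z x * (\<integral>y. exp (- (1 / (real n + 1)) * b y) \<partial>Q x)) ^ n \<le> Z x ^ Suc n"
    using Z_pos[of x] by (simp add: integral_Q Z_def[symmetric])
  then have "Z x ^ Suc n * ((\<integral>y. exp (?r * a y) \<partial>Q x) * (\<integral>y. exp (- (1 / (real n + 1)) * b y) \<partial>Q x) ^ n) \<le> Z x ^ Suc n * 1"
    by (simp add: power_mult_distrib mult_ac)
  then have le1: "(\<integral>y. exp (?r * a y) \<partial>Q x) * (\<integral>y. exp (- (1 / (real n + 1)) * b y) \<partial>Q x) ^ n \<le> 1"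
    by (subst (asm) mult_le_cancel_left_pos) (simp_all add: Z_pos del: power_Suc)
  have ib: "integrable (Q x) b" using bdd by (intro integrable_Q_bounded) auto
  have posa: "0 < (\<integral>y. exp (?r * a y) \<partial>Q x)"
  proof -
    have "exp (\<integral>y. ?r * a y \<partial>Q x) \<le> (\<integral>y. exp (?r * a y) \<partial>Q x)"
      using bdd by (intro P.exp_expectation_le iexp integrable_mult_right integrable_Q_bounded) auto
    then show ?thesis using exp_gt_zero less_le_trans by blast
  qed
  \<comment> \<open>Jensen replaces the second integral by the exponential of a mean of
    \<open>b\<close>, and the \<open>n\<close>-th power restores the coefficient
    \<open>n / (n + 1)\<close>.\<close>
  have "exp (- ?r * (\<integral>y. b y \<partial>Q x)) = exp (\<integral>y. - (1 / (real n + 1)) * b y \<partial>Q x) ^ n"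
    by (simp add: exp_of_nat_mult[symmetric])
  also have "\<dots> \<le> (\<integral>y. exp (- (1 / (real n + 1)) * b y) \<partial>Q x) ^ n"
    using ib bdd by (intro power_mono P.exp_expectation_le iexp integrable_mult_right) auto
  finally have "(\<integral>y. exp (?r * a y) \<partial>Q x) * exp (- ?r * (\<integral>y. b y \<partial>Q x)) \<le> 1"
    using le1 posa by (meson mult_left_mono less_imp_le order_trans)
  then have "(\<integral>y. exp (?r * a y) \<partial>Q x) \<le> exp (?r * (\<integral>y. b y \<partial>Q x))"
    by (simp add: exp_minus divide_inverse[symmetric] pos_divide_le_eq)
  then show ?thesis using posa by (metis exp_gt_zero ln_exp ln_le_cancel_iff)
qed

text \<open>\<open>log_Harnack_kernel\<close> bounds the mean of a multiple of \<open>a\<close>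
  under \<open>Q x\<close> by a log-exponential integral under \<open>Q x'\<close>, and
  \<open>transport_entropy_dual\<close> bounds the latter by the mean of \<open>b\<close>. The two
  constants agree, so the cost coefficient is preserved.\<close>

lemma Wasserstein_contraction_dual:
  fixes a b :: "'a \<Rightarrow> real"
  assumes [measurable]: "a \<in> borel_measurable borel" "b \<in> borel_measurable borel"
    and bdd: "\<And>y. \<bar>a y\<bar> \<le> B" "\<And>y. \<bar>b y\<bar> \<le> B"
    and ab: "\<And>y y'. a y - b y' \<le> c * (norm (y - y'))\<^sup>2"
    and c: "c > 0"
  shows "(\<integral>y. a y \<partial>Q x) - (\<integral>y. b y \<partial>Q x') \<le> c * (norm (x - x'))\<^sup>2"
proof -
  \<comment> \<open>Rescaling by \<open>s\<close> turns the cost coefficient \<open>c\<close> into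
    \<open>1 / (2 * \<eta>)\<close>, the one of the transport inequality.\<close>
  define s where "s = 1 / (2 * \<eta> * c)"
  have s: "s > 0" using c eta_pos by (simp add: s_def)
  define D where "D = s * ((\<integral>y. a y \<partial>Q x) - (\<integral>y. b y \<partial>Q x'))"
  have "D \<le> (norm (x - x'))\<^sup>2 / (2 * \<eta>)"
  proof (rule le_if_le_add_inverse_nat)
    fix n :: nat assume n: "n > 0"
    let ?r = "real n / (real n + 1)"
    have "ln (\<integral>y. exp (?r * (s * a y)) \<partial>Q x') \<le> ?r * (\<integral>y. s * b y \<partial>Q x')"
    proof (rule transport_entropy_dual[where B="s * B"])
      fix y y'
      have "s * (a y - b y') \<le> s * (c * (norm (y - y'))\<^sup>2)"
        using ab s by (intro mult_left_mono) auto
      then show "s * a y - s * b y' \<le> (norm (y - y'))\<^sup>2 / (2 * \<eta>)"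
        using c by (simp add: s_def right_diff_distrib diff_divide_distrib)
    qed (use n s bdd in \<open>auto simp: abs_mult\<close>)
    moreover have "(\<integral>y. ?r * (s * a y) \<partial>Q x) - ln (\<integral>y. exp (?r * (s * a y)) \<partial>Q x') \<le> (norm (x - x'))\<^sup>2 / (2 * \<eta>)"
    proof (rule log_Harnack_kernel)
      fix y
      have "\<bar>?r * (s * a y)\<bar> = ?r * (s * \<bar>a y\<bar>)" using s by (simp add: abs_mult)
      also have "\<dots> \<le> ?r * (s * B)" using s bdd by (intro mult_left_mono) auto
      finally show "\<bar>?r * (s * a y)\<bar> \<le> ?r * (s * B)" .
    qed measurable
    ultimately have "?r * D \<le> (norm (x - x'))\<^sup>2 / (2 * \<eta>)"
      by (simp add: D_def algebra_simps)
    \<comment> \<open>The missing fraction of \<open>D\<close> is of order \<open>1 / n\<close>; the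
      sign of \<open>D\<close> is open, hence the absolute value below.\<close>
    moreover have "D - ?r * D = D / (real n + 1)"
      by (simp add: field_simps add_nonneg_eq_0_iff)
    moreover have "D / (real n + 1) \<le> \<bar>D\<bar> / real n"
    proof -
      have "D / (real n + 1) \<le> \<bar>D\<bar> / (real n + 1)" by (simp add: divide_right_mono)
      also have "\<dots> \<le> \<bar>D\<bar> / real n" using n by (intro divide_left_mono) auto
      finally show ?thesis .
    qed
    ultimately show "D \<le> (norm (x - x'))\<^sup>2 / (2 * \<eta>) + \<bar>D\<bar> / real n" by linarith
  qed
  then have "D \<le> s * (c * (norm (x - x'))\<^sup>2)" using c by (simp add: s_def)
  then show ?thesis using s unfolding D_def by (simp only: mult_le_cancel_left_pos)
qed

text \<open>Contraction costs |x - z|^2 / (2 n \<eta>) from \<open>x\<close> to \<open>z\<close>,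
  the entropy bound costs |z - x'|^2 / (2 \<eta>) from \<open>z\<close> to \<open>x'\<close>. The
  constant in \<open>offdiag\<close> is multiplied out so that \<open>n = 0\<close> makes sense;
  there it is void and \<open>diag\<close> carries the information.\<close>

lemma log_Harnack_step:
  fixes a p :: "'a \<Rightarrow> real" and n :: nat
  assumes [measurable]: "a \<in> borel_measurable borel" "p \<in> borel_measurable borel"
    and bdd: "\<And>y. \<bar>a y\<bar> \<le> B" "\<And>y. exp (- B) \<le> p y" "\<And>y. p y \<le> exp B"
    and diag: "\<And>y. a y \<le> ln (p y)"
    and offdiag: "\<And>y y'. 2 * real n * \<eta> * (a y - ln (p y')) \<le> (norm (y - y'))\<^sup>2"
  shows "2 * real (Suc n) * \<eta> * ((\<integral>y. a y \<partial>Q x) - ln (\<integral>y. p y \<partial>Q x')) \<le> (norm (x - x'))\<^sup>2"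
proof -
  \<comment> \<open>The minimiser of the sum of the two costs: the legs have lengths in the ratio
    \<open>n\<close> to 1, and the sum is |x - x'|^2 / (2 (n + 1) \<eta>).\<close>
  define z where "z = x' + (1 / (real n + 1)) *\<^sub>R (x - x')"
  define d where "d = (norm (x - x'))\<^sup>2"
  have N: "real n + 1 > 0" by simp
  have p: "0 < p y" for y using bdd(2) exp_gt_zero less_le_trans by blast
  have lnp: "\<bar>ln (p y)\<bar> \<le> B" for y
  proof -
    have "- B \<le> ln (p y)" using bdd(2) p by (simp add: ln_ge_iff)
    moreover have "ln (p y) \<le> B" using bdd(3) p by (metis ln_exp ln_le_cancel_iff exp_gt_zero)
    ultimately show ?thesis by simp
  qed
  have zx': "z - x' = (1 / (real n + 1)) *\<^sub>R (x - x')" by (simp add: z_def)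
  have "x - z = (1 - 1 / (real n + 1)) *\<^sub>R (x - x')" by (simp add: z_def algebra_simps)
  also have "1 - 1 / (real n + 1) = real n / (real n + 1)" by (simp add: field_simps)
  finally have xz: "x - z = (real n / (real n + 1)) *\<^sub>R (x - x')" .
  have 1: "(norm (z - x'))\<^sup>2 = d / (real n + 1)\<^sup>2"
    unfolding zx' d_def by (simp add: power_divide)
  have 2: "(norm (x - z))\<^sup>2 = (real n)\<^sup>2 * d / (real n + 1)\<^sup>2"
    unfolding xz d_def by (simp add: power_divide power_mult_distrib)
  have "(\<integral>y. a y \<partial>Q x) - (\<integral>y. ln (p y) \<partial>Q z) \<le> real n * d / ((real n + 1)\<^sup>2 * (2 * \<eta>))"
  proof (cases "n = 0")
    \<comment> \<open>Here the first leg is a single point, and integrating \<open>diag\<close>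
      takes the place of contraction.\<close>
    case True
    then have "z = x" by (simp add: z_def)
    moreover have "(\<integral>y. a y \<partial>Q x) \<le> (\<integral>y. ln (p y) \<partial>Q x)"
      using bdd lnp diag by (intro integral_mono integrable_Q_bounded) auto
    ultimately show ?thesis using True by simp
  next
    case False
    have "(\<integral>y. a y \<partial>Q x) - (\<integral>y. ln (p y) \<partial>Q z) \<le> (1 / (2 * real n * \<eta>)) * (norm (x - z))\<^sup>2"
    proof (rule Wasserstein_contraction_dual[where B=B])
      fix y y' show "a y - ln (p y') \<le> 1 / (2 * real n * \<eta>) * (norm (y - y'))\<^sup>2"
        using offdiag[of y y'] False eta_pos by (simp add: field_simps)
    qed (use bdd lnp False eta_pos in auto)
    also have "\<dots> = real n * d / ((real n + 1)\<^sup>2 * (2 * \<eta>))"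
      unfolding 2 using False by (simp add: field_simps power2_eq_square)
    finally show ?thesis .
  qed
  moreover have "(\<integral>y. ln (p y) \<partial>Q z) - ln (\<integral>y. exp (ln (p y)) \<partial>Q x') \<le> (norm (z - x'))\<^sup>2 / (2 * \<eta>)"
    by (rule log_Harnack_kernel[where B=B]) (use lnp in auto)
  then have "(\<integral>y. ln (p y) \<partial>Q z) - ln (\<integral>y. p y \<partial>Q x') \<le> d / ((real n + 1)\<^sup>2 * (2 * \<eta>))"
    using p by (simp add: 1)
  ultimately have "(\<integral>y. a y \<partial>Q x) - ln (\<integral>y. p y \<partial>Q x')
    \<le> real n * d / ((real n + 1)\<^sup>2 * (2 * \<eta>)) + d / ((real n + 1)\<^sup>2 * (2 * \<eta>))" by linarith
  also have "\<dots> = d * (real n + 1) / ((real n + 1)\<^sup>2 * (2 * \<eta>))"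
    by (simp add: add_divide_distrib[symmetric] algebra_simps)
  also have "\<dots> = d / (2 * real (Suc n) * \<eta>)"
    by (simp add: power2_eq_square mult_ac)
  finally show ?thesis
    using eta_pos by (simp add: d_def pos_le_divide_eq mult.commute)
qed

end

section \<open>A variational bound on the relative entropy\<close>

lemma mult_ln_ge: "- 1 \<le> r * ln r" if "0 \<le> r" for r :: real
proof (cases "r = 0")
  case False
  with that have "r > 0" by simp
  have "ln (1 / r) \<le> 1 / r - 1" using \<open>r > 0\<close> by (intro ln_le_minus_one) simp
  then have "- ln r \<le> 1 / r - 1" using \<open>r > 0\<close> by (simp add: ln_div)
  then have "r * (- ln r) \<le> r * (1 / r - 1)" using \<open>r > 0\<close> by (intro mult_left_mono) auto
  then show ?thesis using \<open>r > 0\<close> by (simp add: algebra_simps)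
qed simp

text \<open>The harder half of the Donsker--Varadhan formula: the supremum over bounded test
  functions dominates the relative entropy. As \<open>KL_div\<close> is infinite by default,
  absolute continuity and integrability of \<open>r * ln r\<close> have to be extracted from the
  bound too.\<close>

lemma KL_div_le_of_variational:
  fixes \<mu> \<nu> :: "'b measure" and K :: real
  assumes \<mu>: "prob_space \<mu>" and \<nu>: "prob_space \<nu>" and sets: "sets \<mu> = sets \<nu>"
    and DV: "\<And>u B. u \<in> borel_measurable \<nu> \<Longrightarrow> (\<And>x. \<bar>u x\<bar> \<le> B) \<Longrightarrow>
      (\<integral>x. u x \<partial>\<mu>) - ln (\<integral>x. exp (u x) \<partial>\<nu>) \<le> K"
  shows "KL_div \<mu> \<nu> \<le> ereal K"
proof -
  interpret M: prob_space \<mu> by (rule \<mu>)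
  interpret N: prob_space \<nu> by (rule \<nu>)
  have ac: "absolutely_continuous \<nu> \<mu>"
    unfolding absolutely_continuous_def
  proof
    fix A assume A: "A \<in> null_sets \<nu>"
    then have [measurable]: "A \<in> sets \<nu>" "A \<in> sets \<mu>" using sets by (auto simp: null_sets_def)
    \<comment> \<open>Testing with \<open>n\<close> times the indicator of a null set of \<nu>: the
      logarithmic term vanishes, so \<open>n * prob A\<close> stays bounded in
      \<open>n\<close>.\<close>
    have "real n * M.prob A \<le> K" for n :: nat
    proof -
      have AE: "AE x in \<nu>. x \<notin> A" using A by (rule AE_not_in)
      have "(\<integral>x. exp (real n * indicator A x) \<partial>\<nu>) = (\<integral>x. 1 \<partial>\<nu>)"
        by (rule integral_cong_AE) (use AE in \<open>auto simp: indicator_def\<close>)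
      then have "(\<integral>x. exp (real n * indicator A x) \<partial>\<nu>) = 1" by (simp add: N.prob_space)
      moreover have "(\<integral>x. real n * indicator A x \<partial>\<mu>) - ln (\<integral>x. exp (real n * indicator A x) \<partial>\<nu>) \<le> K"
        by (rule DV[where B="real n"]) (auto simp: indicator_def)
      ultimately show ?thesis by simp
    qed
    then have "M.prob A \<le> 0"
      using M.prob_space
      by (metis ex_less_of_nat_mult linorder_not_le)
    then have "M.prob A = 0" by (simp add: measure_le_0_iff)
    then show "A \<in> null_sets \<mu>" by (simp add: null_sets_def M.emeasure_eq_measure)
  qed
  define r where "r = (\<lambda>x. enn2real (RN_deriv \<nu> \<mu> x))"
  have [measurable]: "r \<in> borel_measurable \<nu>" unfolding r_def by measurable
  have r0: "0 \<le> r x" for x by (simp add: r_def)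
  have dens: "density \<nu> (\<lambda>x. ennreal (r x)) = \<mu>"
  proof -
    have "density \<nu> (RN_deriv \<nu> \<mu>) = \<mu>" by (rule N.density_RN_deriv[OF ac sets])
    moreover have "AE x in \<nu>. RN_deriv \<nu> \<mu> x = ennreal (r x)"
      using N.RN_deriv_finite[OF _ ac sets] M.sigma_finite_measure_axioms
      by (auto simp: r_def top.not_eq_extremum elim: eventually_mono)
    then have "density \<nu> (RN_deriv \<nu> \<mu>) = density \<nu> (\<lambda>x. ennreal (r x))"
      by (intro density_cong) auto
    ultimately show ?thesis by simp
  qed
  have ir: "integrable \<nu> r" and int_r: "(\<integral>x. r x \<partial>\<nu>) = 1"
  proof -
    have "(\<integral>\<^sup>+x. ennreal (r x) \<partial>\<nu>) = emeasure \<mu> (space \<mu>)"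
      by (subst (1 2) dens[symmetric]) (simp add: emeasure_density cong: nn_integral_cong)
    then have *: "(\<integral>\<^sup>+x. ennreal (r x) \<partial>\<nu>) = ennreal 1" by (simp add: M.emeasure_space_1)
    then show "integrable \<nu> r" using r0 by (intro integrableI_nonneg) auto
    show "(\<integral>x. r x \<partial>\<nu>) = 1" using * r0 by (intro integral_eq_nn_integral[THEN trans]) auto
  qed
  \<comment> \<open>Truncations of \<open>ln r\<close>, the optimal test function. The zero set is
    treated apart because \<open>ln 0 = 0\<close>: the value \<open>- m\<close> keeps
    \<open>exp (u m x)\<close> below \<open>r x + exp (- m)\<close> there.\<close>
  define u where "u = (\<lambda>(m::nat) x. if r x = 0 then - real m else max (- real m) (min (real m) (ln (r x))))"
  have [measurable]: "u m \<in> borel_measurable \<nu>" for m unfolding u_def by measurable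
  have ub: "\<bar>u m x\<bar> \<le> real m" for m x unfolding u_def by auto
  have lower: "- 1 \<le> r x * u m x" for m x
  proof (cases "r x = 0 \<or> ln (r x) \<ge> 0")
    case True
    then have "0 \<le> r x * u m x" using r0[of x] by (auto simp: u_def le_max_iff_disj intro!: mult_nonneg_nonneg)
    then show ?thesis by simp
  next
    case False
    then have "ln (r x) \<le> u m x" by (auto simp: u_def)
    then have "r x * ln (r x) \<le> r x * u m x" using r0 by (intro mult_left_mono) auto
    then show ?thesis using mult_ln_ge[OF r0, of x] by linarith
  qed
  have bound: "(\<integral>x. r x * u m x \<partial>\<nu>) \<le> K + exp (- real m)" for m
  proof -
    have "(\<integral>x. u m x \<partial>\<mu>) = (\<integral>x. r x *\<^sub>R u m x \<partial>\<nu>)"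
      by (subst dens[symmetric], rule integral_density) (use r0 in auto)
    moreover have "(\<integral>x. u m x \<partial>\<mu>) - ln (\<integral>x. exp (u m x) \<partial>\<nu>) \<le> K"
      by (rule DV[OF _ ub]) measurable
    moreover have "ln (\<integral>x. exp (u m x) \<partial>\<nu>) \<le> exp (- real m)"
    proof -
      have ie: "integrable \<nu> (\<lambda>x. exp (u m x))"
        using ub[of m] by (intro N.integrable_const_bound[where B="exp (real m)"]) (auto simp: abs_le_iff)
      have "(\<integral>x. exp (u m x) \<partial>\<nu>) \<le> (\<integral>x. r x + exp (- real m) \<partial>\<nu>)"
      proof (rule integral_mono[OF ie])
        fix x
        show "exp (u m x) \<le> r x + exp (- real m)"
        proof (cases "r x = 0 \<or> ln (r x) \<le> - real m")
          case True
          then have "u m x = - real m" by (auto simp: u_def)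
          then show ?thesis using r0[of x] by simp
        next
          case False
          then have "u m x \<le> ln (r x)" "r x > 0" using r0[of x] by (auto simp: u_def)
          then have "exp (u m x) \<le> r x" by (metis exp_le_cancel_iff exp_ln)
          then show ?thesis by (simp add: add_increasing2)
        qed
      qed (use ir in auto)
      also have "\<dots> = 1 + exp (- real m)" using ir int_r by (simp add: N.prob_space)
      finally have le: "(\<integral>x. exp (u m x) \<partial>\<nu>) \<le> 1 + exp (- real m)" .
      have "0 < (\<integral>x. exp (u m x) \<partial>\<nu>)"
      proof -
        have "integrable \<nu> (u m)" using ub[of m] by (intro N.integrable_const_bound[where B="real m"]) auto
        from N.exp_expectation_le[OF this ie] show ?thesis using exp_gt_zero less_le_trans by blast
      qed
      then have "ln (\<integral>x. exp (u m x) \<partial>\<nu>) \<le> (\<integral>x. exp (u m x) \<partial>\<nu>) - 1" by (rule ln_le_minus_one)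
      then show ?thesis using le by linarith
    qed
    ultimately show ?thesis by simp
  qed
  have iru: "integrable \<nu> (\<lambda>x. r x * u m x)" for m
  proof (rule Bochner_Integration.integrable_bound)
    show "integrable \<nu> (\<lambda>x. real m * r x)" using ir by simp
    show "AE x in \<nu>. norm (r x * u m x) \<le> norm (real m * r x)"
      using mult_left_mono[OF ub r0] r0 by (intro AE_I2) (simp add: abs_mult mult.commute)
  qed measurable
  \<comment> \<open>Adding 1 makes the integrands nonnegative by \<open>lower\<close>, as Fatou's
    lemma requires.\<close>
  have nn: "(\<integral>\<^sup>+x. ennreal (r x * u m x + 1) \<partial>\<nu>) \<le> ennreal (K + 1 + exp (- real m))" for m
  proof -
    have "(\<integral>\<^sup>+x. ennreal (r x * u m x + 1) \<partial>\<nu>) = ennreal (\<integral>x. r x * u m x + 1 \<partial>\<nu>)"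
    proof (rule nn_integral_eq_integral)
      show "AE x in \<nu>. 0 \<le> r x * u m x + 1"
      proof (rule AE_I2)
        fix x show "0 \<le> r x * u m x + 1" using lower[of x m] by linarith
      qed
    qed (use iru in auto)
    also have "(\<integral>x. r x * u m x + 1 \<partial>\<nu>) = (\<integral>x. r x * u m x \<partial>\<nu>) + 1"
      using iru by (simp add: N.prob_space)
    finally show ?thesis using bound[of m] by (simp add: ennreal_leI)
  qed
  have lim: "(\<lambda>m. ennreal (r x * u m x + 1)) \<longlonglongrightarrow> ennreal (r x * ln (r x) + 1)" for x
  proof (cases "r x = 0")
    case True then show ?thesis by simp
  next
    case False
    obtain m0 :: nat where m0: "\<bar>ln (r x)\<bar> \<le> real m0" using real_arch_simple by blast
    have "u m x = ln (r x)" if "m \<ge> m0" for m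
    proof -
      have "real m0 \<le> real m" using that by simp
      then show ?thesis using m0 False by (auto simp: u_def)
    qed
    then show ?thesis by (intro tendsto_eventually) (auto simp: eventually_sequentially intro!: exI[of _ m0])
  qed
  have "(\<integral>\<^sup>+x. ennreal (r x * ln (r x) + 1) \<partial>\<nu>) = (\<integral>\<^sup>+x. liminf (\<lambda>m. ennreal (r x * u m x + 1)) \<partial>\<nu>)"
    using lim by (intro nn_integral_cong) (metis lim_imp_Liminf sequentially_bot)
  also have "\<dots> \<le> liminf (\<lambda>m. \<integral>\<^sup>+x. ennreal (r x * u m x + 1) \<partial>\<nu>)"
    by (rule nn_integral_liminf) measurable
  also have "\<dots> \<le> liminf (\<lambda>m. ennreal (K + 1 + exp (- real m)))"
    by (rule Liminf_mono) (simp add: nn)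
  also have "\<dots> = ennreal (K + 1)"
  proof (rule lim_imp_Liminf)
    have "(\<lambda>m. K + 1 + exp (- real m)) \<longlonglongrightarrow> K + 1 + 0"
      by (intro tendsto_add tendsto_const filterlim_compose[OF exp_at_bot]
        filterlim_compose[OF filterlim_uminus_at_bot_at_top filterlim_real_sequentially])
    then show "(\<lambda>m. ennreal (K + 1 + exp (- real m))) \<longlonglongrightarrow> ennreal (K + 1)"
      by (intro tendsto_ennrealI) simp
  qed simp
  finally have fin: "(\<integral>\<^sup>+x. ennreal (r x * ln (r x) + 1) \<partial>\<nu>) \<le> ennreal (K + 1)" .
  have nonneg: "0 \<le> r x * ln (r x) + 1" for x using mult_ln_ge[OF r0, of x] by linarith
  have i1: "integrable \<nu> (\<lambda>x. r x * ln (r x) + 1)"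
    using nonneg fin by (intro integrableI_nonneg) (auto intro: le_less_trans)
  then have "integrable \<nu> (\<lambda>x. (r x * ln (r x) + 1) - 1)" by (intro Bochner_Integration.integrable_diff) auto
  then have i2: "integrable \<nu> (\<lambda>x. r x * ln (r x))" by simp
  \<comment> \<open>The zero test function gives the sign of \<open>K\<close>, so that the
    comparison in \<open>ennreal\<close> carries back to the reals.\<close>
  have K0: "0 \<le> K" using DV[of "\<lambda>_. 0" 0] by (simp add: N.prob_space)
  have "ennreal (\<integral>x. r x * ln (r x) + 1 \<partial>\<nu>) \<le> ennreal (K + 1)"
    using fin nonneg i1 by (subst nn_integral_eq_integral[symmetric]) auto
  then have "(\<integral>x. r x * ln (r x) + 1 \<partial>\<nu>) \<le> K + 1" using K0 by (subst (asm) ennreal_le_iff) auto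
  then have "(\<integral>x. r x * ln (r x) \<partial>\<nu>) \<le> K" using i2 by (simp add: N.prob_space)
  then show ?thesis
    using ac sets i2 by (simp add: KL_div_def r_def Let_def)
qed

section \<open>Integrability, disintegration and stationarity\<close>

text \<open>Translations and reflections preserve null sets; passing to a measurable null superset
  \<open>N\<close> covers predicates of unknown measurability.\<close>

lemma AE_lborel_reflect:
  fixes c :: real and t :: "'a::euclidean_space"
  assumes "AE x in lborel. P x" and c: "\<bar>c\<bar> = 1"
  shows "AE x in lborel. P (t + c *\<^sub>R x)"
proof -
  obtain N where N: "{x. \<not> P x} \<subseteq> N" "N \<in> null_sets lborel"
    using assms(1) unfolding eventually_ae_filter by auto
  then have [measurable]: "N \<in> sets borel" by (auto simp: null_sets_def)
  have "c \<noteq> 0" using c by auto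
  then have eq: "lborel = distr lborel borel (\<lambda>x. t + c *\<^sub>R x)"
    using lborel_affine[of c t] by (simp add: c density_1)
  have "AE x in lborel. x \<notin> N" using N(2) by (rule AE_not_in)
  then have "AE x in distr lborel borel (\<lambda>x. t + c *\<^sub>R x). x \<notin> N" by (simp only: eq[symmetric])
  then have "AE x in lborel. t + c *\<^sub>R x \<notin> N"
    by (subst (asm) AE_distr_iff) auto
  then show ?thesis by eventually_elim (use N(1) in auto)
qed

text \<open>By Fubini the weight is integrable for almost every \<open>x\<close>; every \<open>x\<close> is the midpoint of two such points,
  and the weight at a midpoint is dominated by the weights at the two ends.\<close>

lemma gibbs_weight_integrable:
  fixes f g :: "'a::euclidean_space \<Rightarrow> real"
  assumes norm: "integrable lborel (gibbs_joint_unnorm \<eta> f g)"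
    and [measurable]: "g \<in> borel_measurable borel"
  shows "integrable lborel (\<lambda>y. exp (- g y - (norm (x - y))\<^sup>2 / (2 * \<eta>)))"
proof -
  let ?W = "\<lambda>x y. exp (- g y - (norm (x - y))\<^sup>2 / (2 * \<eta>))"
  have "AE x in lborel. integrable lborel (\<lambda>y. gibbs_joint_unnorm \<eta> f g (x, y))"
    by (rule lborel_pair.AE_integrable_fst') (simp add: lborel_prod norm)
  moreover have "gibbs_joint_unnorm \<eta> f g (x, y) = exp (- f x) * ?W x y" for x y
    by (simp add: gibbs_joint_unnorm_def exp_add[symmetric])
  ultimately have ae: "AE x in lborel. integrable lborel (?W x)"
    by simp
  have both: "AE v in lborel. integrable lborel (?W (x + 1 *\<^sub>R v)) \<and> integrable lborel (?W (x + (- 1) *\<^sub>R v))"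
    using AE_lborel_reflect[OF ae, of 1 x] AE_lborel_reflect[OF ae, of "- 1" x] by simp
  have "\<exists>v. integrable lborel (?W (x + 1 *\<^sub>R v)) \<and> integrable lborel (?W (x + (- 1) *\<^sub>R v))"
  proof (rule ccontr)
    assume "\<nexists>v. integrable lborel (?W (x + 1 *\<^sub>R v)) \<and> integrable lborel (?W (x + (- 1) *\<^sub>R v))"
    then have "AE v in (lborel :: 'a measure). False" using both by (auto elim: eventually_mono)
    then show False by (simp add: AE_iff_null null_sets_def)
  qed
  then obtain v where v: "integrable lborel (?W (x + v))" "integrable lborel (?W (x - v))" by auto
  show ?thesis
  proof (rule Bochner_Integration.integrable_bound)
    show "integrable lborel (\<lambda>y. exp ((norm v)\<^sup>2 / (2 * \<eta>)) * (?W (x + v) y + ?W (x - v) y))"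
      using v by simp
    show "AE y in lborel. norm (?W x y) \<le> norm (exp ((norm v)\<^sup>2 / (2 * \<eta>)) * (?W (x + v) y + ?W (x - v) y))"
    proof (rule AE_I2)
      fix y
      let ?\<alpha> = "- g y - (norm (x + v - y))\<^sup>2 / (2 * \<eta>)" and ?\<beta> = "- g y - (norm (x - v - y))\<^sup>2 / (2 * \<eta>)"
      \<comment> \<open>Parallelogram law: the exponent at the midpoint is the average of the
        exponents at the ends plus a constant in \<open>y\<close>, so a multiple of the sum of the
        end weights dominates.\<close>
      have "2 * (norm (x - y))\<^sup>2 = (norm (x + v - y))\<^sup>2 + (norm (x - v - y))\<^sup>2 - 2 * (norm v)\<^sup>2"
        by (simp add: power2_norm_eq_inner inner_simps inner_commute algebra_simps)
      then have "2 * ((norm (x - y))\<^sup>2 / (2 * \<eta>))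
        = (norm (x + v - y))\<^sup>2 / (2 * \<eta>) + (norm (x - v - y))\<^sup>2 / (2 * \<eta>) - 2 * ((norm v)\<^sup>2 / (2 * \<eta>))"
        by (metis (no_types, opaque_lifting) add_divide_distrib diff_divide_distrib times_divide_eq_right)
      then have eq: "- g y - (norm (x - y))\<^sup>2 / (2 * \<eta>) = (norm v)\<^sup>2 / (2 * \<eta>) + (?\<alpha> + ?\<beta>) / 2"
        by (simp add: field_simps)
      have "exp ((s + t) / 2) \<le> exp s + exp t" for s t :: real
      proof -
        have "exp ((s + t) / 2) \<le> exp (max s t)" by (simp add: max_def)
        also have "\<dots> \<le> exp s + exp t" by (simp add: max_def)
        finally show ?thesis .
      qed
      from this[of ?\<alpha> ?\<beta>] show "norm (?W x y) \<le> norm (exp ((norm v)\<^sup>2 / (2 * \<eta>)) * (?W (x + v) y + ?W (x - v) y))"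
        unfolding eq exp_add by (simp add: abs_mult add_nonneg_nonneg)
    qed
  qed measurable
qed

section \<open>Exchange of the two coordinates\<close>

lemma gibbs_joint_swap: "gibbs_joint_unnorm \<eta> g f (prod.swap z) = gibbs_joint_unnorm \<eta> f g z"
  by (simp add: gibbs_joint_unnorm_def norm_minus_commute)

lemma lborel_distr_swap: "distr lborel borel prod.swap = (lborel :: ('a::euclidean_space \<times> 'a) measure)"
proof -
  have "(lborel \<Otimes>\<^sub>M lborel :: ('a \<times> 'a) measure) = distr (lborel \<Otimes>\<^sub>M lborel) (lborel \<Otimes>\<^sub>M lborel) (\<lambda>(x, y). (y, x))"
    by (rule lborel_pair.distr_pair_swap)
  also have "\<dots> = distr lborel borel prod.swap"
    unfolding lborel_prod by (rule distr_cong) auto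
  finally show ?thesis by (simp add: lborel_prod)
qed

lemma fst_snd_measurable:
  "fst \<in> borel_measurable (borel :: ('a::euclidean_space \<times> 'a) measure)"
  "snd \<in> borel_measurable (borel :: ('a::euclidean_space \<times> 'a) measure)"
  by (intro borel_measurable_continuous_onI continuous_intros)+

lemma swap_measurable [measurable]: "prod.swap \<in> borel_measurable (borel :: ('a::euclidean_space \<times> 'a) measure)"
  by (intro borel_measurable_continuous_onI continuous_on_swap)

lemma gibbs_joint_swap_integrable:
  assumes "integrable lborel (gibbs_joint_unnorm \<eta> f g)"
  shows "integrable lborel (gibbs_joint_unnorm \<eta> g f)"
proof -
  have "integrable (distr lborel borel prod.swap) (gibbs_joint_unnorm \<eta> f g)"
    using assms by (simp add: lborel_distr_swap)
  then have "integrable lborel (\<lambda>z. gibbs_joint_unnorm \<eta> f g (prod.swap z))"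
    by (subst (asm) integrable_distr_eq) (use assms[THEN borel_measurable_integrable] in auto)
  then show ?thesis by (simp add: gibbs_joint_swap)
qed

text \<open>With this, what is proved for the first marginal and the kernel of \<open>g\<close>
  transfers to the second marginal and the kernel of \<open>f\<close>.\<close>

lemma gibbs_target_swap:
  assumes "integrable lborel (gibbs_joint_unnorm \<eta> f g)"
  shows "gibbs_target \<eta> g f = distr (gibbs_target \<eta> f g) borel prod.swap"
proof -
  note [measurable] = assms[THEN borel_measurable_integrable]
  have [measurable]: "gibbs_joint_unnorm \<eta> g f \<in> borel_measurable borel"
    using gibbs_joint_swap_integrable[OF assms, THEN borel_measurable_integrable] by simp
  have "(\<integral>w. gibbs_joint_unnorm \<eta> g f w \<partial>lborel) = (\<integral>w. gibbs_joint_unnorm \<eta> g f w \<partial>distr lborel borel prod.swap)"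
    by (simp add: lborel_distr_swap)
  also have "\<dots> = (\<integral>w. gibbs_joint_unnorm \<eta> f g w \<partial>lborel)"
    by (subst integral_distr) (simp_all add: gibbs_joint_swap)
  finally have N: "(\<integral>w. gibbs_joint_unnorm \<eta> g f w \<partial>lborel) = (\<integral>w. gibbs_joint_unnorm \<eta> f g w \<partial>lborel)" .
  let ?N = "\<integral>w. gibbs_joint_unnorm \<eta> f g w \<partial>lborel"
  have "gibbs_target \<eta> g f = density (distr lborel borel prod.swap) (\<lambda>z. ennreal (gibbs_joint_unnorm \<eta> g f z / ?N))"
    by (simp add: gibbs_target_def N lborel_distr_swap)
  also have "\<dots> = distr (density lborel (\<lambda>z. ennreal (gibbs_joint_unnorm \<eta> g f (prod.swap z) / ?N))) borel prod.swap"
    by (rule density_distr) auto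
  finally show ?thesis by (simp add: gibbs_target_def gibbs_joint_swap)
qed

section \<open>Markov kernels and disintegration of the target\<close>

context proximal_kernel
begin

lemma emeasure_Q: "A \<in> sets borel \<Longrightarrow> emeasure (Q x) A = (\<integral>\<^sup>+y. ennreal (W x y / Z x) * indicator A y \<partial>lborel)"
  by (simp add: Q_eq emeasure_density)

lemma nn_integral_Q:
  "\<phi> \<in> borel_measurable borel \<Longrightarrow> (\<integral>\<^sup>+y. \<phi> y \<partial>Q x) = (\<integral>\<^sup>+y. ennreal (W x y / Z x) * \<phi> y \<partial>lborel)"
  by (simp add: Q_eq nn_integral_density)

lemma Q_kernel [measurable]: "Q \<in> borel \<rightarrow>\<^sub>M subprob_algebra borel"
proof (rule measurable_subprob_algebra)
  fix A :: "'a set" assume [measurable]: "A \<in> sets borel"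
  show "(\<lambda>x. emeasure (Q x) A) \<in> borel_measurable borel"
    by (simp add: emeasure_Q)
qed (auto intro: prob_space_imp_subprob_space prob_space_Q)

text \<open>The last half-step with its starting point retained: for \<open>h = g\<close>, the
  kernel inside \<open>gibbs_law_XY\<close>.\<close>

definition J :: "'a \<Rightarrow> ('a \<times> 'a) measure" where
  "J x = Q x \<bind> (\<lambda>y. return borel (x, y))"

lemma J_eq: "J x = distr (Q x) borel (\<lambda>y. (x, y))"
  unfolding J_def by (rule bind_return_distr') auto

lemma J_kernel [measurable]: "J \<in> borel \<rightarrow>\<^sub>M subprob_algebra borel"
  unfolding J_def[abs_def] by measurable

lemma prob_space_J: "prob_space (J x)"
  unfolding J_eq by (rule prob_space.prob_space_distr[OF prob_space_Q]) auto

lemma prob_space_bind_Q: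
  assumes "prob_space \<mu>" "sets \<mu> = sets borel"
  shows "prob_space (\<mu> \<bind> Q)" "sets (\<mu> \<bind> Q) = sets borel"
proof -
  have ne: "space \<mu> \<noteq> {}" using assms(1) by (rule prob_space.not_empty)
  show "sets (\<mu> \<bind> Q) = sets borel" by (rule sets_bind[OF _ ne]) simp
  show "prob_space (\<mu> \<bind> Q)"
    using assms(2) by (intro prob_space.prob_space_bind[OF assms(1), where S=borel]) (auto simp: prob_space_Q measurable_cong_sets[OF assms(2) refl])
qed

lemma integral_bind_Q:
  fixes \<phi> :: "'a \<Rightarrow> real"
  assumes "prob_space \<mu>" "sets \<mu> = sets borel" "\<phi> \<in> borel_measurable borel" "\<And>y. \<bar>\<phi> y\<bar> \<le> B"
  shows "(\<integral>y. \<phi> y \<partial>(\<mu> \<bind> Q)) = (\<integral>x. (\<integral>y. \<phi> y \<partial>Q x) \<partial>\<mu>)"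
proof (rule integral_bind[where K=borel])
  show "finite_measure \<mu>" by (rule prob_space.finite_measure[OF assms(1)])
  show "AE x in \<mu>. emeasure (Q x) (space (Q x)) \<le> ennreal 1"
    using prob_space.emeasure_space_1[OF prob_space_Q] by simp
qed (use assms in \<open>auto simp: measurable_cong_sets[OF assms(2) refl]\<close>)

lemma integral_bind_J:
  fixes u :: "'a \<times> 'a \<Rightarrow> real"
  assumes "prob_space \<mu>" "sets \<mu> = sets borel" and u [measurable]: "u \<in> borel_measurable borel" and "\<And>z. \<bar>u z\<bar> \<le> B"
  shows "(\<integral>z. u z \<partial>(\<mu> \<bind> J)) = (\<integral>x. (\<integral>y. u (x, y) \<partial>Q x) \<partial>\<mu>)"
proof -
  have "(\<integral>z. u z \<partial>(\<mu> \<bind> J)) = (\<integral>x. (\<integral>z. u z \<partial>J x) \<partial>\<mu>)"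
  proof (rule integral_bind[where K=borel])
    show "finite_measure \<mu>" by (rule prob_space.finite_measure[OF assms(1)])
    show "AE x in \<mu>. emeasure (J x) (space (J x)) \<le> ennreal 1"
      using prob_space.emeasure_space_1[OF prob_space_J] by simp
  qed (use assms in \<open>auto simp: measurable_cong_sets[OF assms(2) refl]\<close>)
  also have "(\<lambda>x. \<integral>z. u z \<partial>J x) = (\<lambda>x. \<integral>y. u (x, y) \<partial>Q x)"
    unfolding J_eq by (intro ext integral_distr) auto
  finally show ?thesis .
qed

lemma integral_Q_pair_measurable:
  fixes u :: "'a \<times> 'a \<Rightarrow> real"
  assumes [measurable]: "u \<in> borel_measurable borel"
  shows "(\<lambda>x. \<integral>y. u (x, y) \<partial>Q x) \<in> borel_measurable borel"
proof -
  have [measurable]: "u \<in> borel_measurable (borel \<Otimes>\<^sub>M borel)" unfolding borel_prod by measurable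
  show ?thesis by (simp add: integral_Q)
qed

lemma integral_Q_measurable:
  fixes \<phi> :: "'a \<Rightarrow> real"
  assumes [measurable]: "\<phi> \<in> borel_measurable borel"
  shows "(\<lambda>x. \<integral>y. \<phi> y \<partial>Q x) \<in> borel_measurable borel"
  by (simp add: integral_Q)

lemma integral_Q_bounds:
  fixes \<phi> :: "'a \<Rightarrow> real"
  assumes [measurable]: "\<phi> \<in> borel_measurable borel" and "\<And>y. l \<le> \<phi> y" "\<And>y. \<phi> y \<le> m"
  shows "l \<le> (\<integral>y. \<phi> y \<partial>Q x)" "(\<integral>y. \<phi> y \<partial>Q x) \<le> m"
proof -
  interpret P: prob_space "Q x" by (rule prob_space_Q)
  have "\<bar>\<phi> y\<bar> \<le> max \<bar>l\<bar> \<bar>m\<bar>" for y using assms(2,3)[of y] by auto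
  then have i: "integrable (Q x) \<phi>" by (rule integrable_Q_bounded[OF assms(1)])
  show "l \<le> (\<integral>y. \<phi> y \<partial>Q x)" "(\<integral>y. \<phi> y \<partial>Q x) \<le> m"
    using P.integral_ge_const[OF i, of l] P.integral_le_const[OF i, of m] assms(2,3) by auto
qed

text \<open>The joint density splits as \<open>c x * W x y\<close>, with \<open>f\<close> and the
  normaliser in \<open>c\<close>; given \<open>x\<close> it is thus proportional to the weight of
  \<open>Q x\<close>. The marginal density is not computed: functions of \<open>x\<close> are
  integrated against the joint law itself.\<close>

lemma gibbs_target_disintegration:
  assumes int: "integrable lborel (gibbs_joint_unnorm \<eta> f h)" and [measurable]: "f \<in> borel_measurable borel"
  shows "gibbs_target \<eta> f h = distr (gibbs_target \<eta> f h) borel fst \<bind> J"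
proof (rule measure_eqI)
  let ?\<pi> = "gibbs_target \<eta> f h" and ?N = "\<integral>w. gibbs_joint_unnorm \<eta> f h w \<partial>lborel"
  have s: "sets ?\<pi> = sets borel" by (simp add: gibbs_target_def)
  have ne: "space (distr ?\<pi> borel fst) \<noteq> {}" by simp
  have sJ: "sets (J x) = sets borel" for x by (simp add: J_eq)
  show "sets ?\<pi> = sets (distr ?\<pi> borel fst \<bind> J)"
    unfolding s by (rule sets_bind[OF sJ ne, symmetric])
  fix A assume "A \<in> sets ?\<pi>"
  then have [measurable]: "A \<in> sets borel" by (simp add: s)
  have [measurable]: "A \<in> sets (borel \<Otimes>\<^sub>M borel)" unfolding borel_prod by measurable
  define c where "c = (\<lambda>x. ennreal (exp (- f x) / ?N))"
  have [measurable]: "c \<in> borel_measurable borel" unfolding c_def by measurable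
  have N0: "0 \<le> ?N" by (intro Bochner_Integration.integral_nonneg) (simp add: gibbs_joint_unnorm_def)
  have joint: "ennreal (gibbs_joint_unnorm \<eta> f h (x, y) / ?N) = c x * ennreal (W x y)" for x y
    unfolding c_def using N0
    by (subst ennreal_mult[symmetric]) (auto simp: W_def gibbs_joint_unnorm_def exp_add[symmetric] intro!: less_imp_le)
  have meas: "(\<lambda>z. ennreal (gibbs_joint_unnorm \<eta> f h z / ?N)) \<in> borel_measurable borel"
    using int[THEN borel_measurable_integrable] by simp
  have nn: "(\<integral>\<^sup>+z. \<phi> z \<partial>?\<pi>) = (\<integral>\<^sup>+x. (\<integral>\<^sup>+y. c x * (ennreal (W x y) * \<phi> (x, y)) \<partial>lborel) \<partial>lborel)"
    if [measurable]: "\<phi> \<in> borel_measurable borel" for \<phi>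
  proof -
    have [measurable]: "\<phi> \<in> borel_measurable (borel \<Otimes>\<^sub>M borel)" unfolding borel_prod by measurable
    have "(\<integral>\<^sup>+z. \<phi> z \<partial>?\<pi>) = (\<integral>\<^sup>+z. ennreal (gibbs_joint_unnorm \<eta> f h z / ?N) * \<phi> z \<partial>lborel)"
      unfolding gibbs_target_def using meas by (intro nn_integral_density) auto
    also have "\<dots> = (\<integral>\<^sup>+z. c (fst z) * (ennreal (W (fst z) (snd z)) * \<phi> z) \<partial>(lborel \<Otimes>\<^sub>M lborel))"
      unfolding lborel_prod
    proof (rule nn_integral_cong)
      fix z show "ennreal (gibbs_joint_unnorm \<eta> f h z / ?N) * \<phi> z = c (fst z) * (ennreal (W (fst z) (snd z)) * \<phi> z)"
        using joint[of "fst z" "snd z"] by (simp add: mult.assoc)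
    qed
    also have "\<dots> = (\<integral>\<^sup>+x. (\<integral>\<^sup>+y. c x * (ennreal (W x y) * \<phi> (x, y)) \<partial>lborel) \<partial>lborel)"
      by (subst lborel.nn_integral_fst[symmetric]) simp_all
    finally show ?thesis .
  qed
  define q where "q = (\<lambda>x. \<integral>\<^sup>+y. ennreal (W x y / Z x) * indicator A (x, y) \<partial>lborel)"
  have [measurable]: "q \<in> borel_measurable borel" unfolding q_def by measurable
  have EJ: "emeasure (J x) A = q x" for x
  proof -
    have "emeasure (J x) A = (\<integral>\<^sup>+z. indicator A z \<partial>J x)" by (simp add: sJ)
    also have "\<dots> = (\<integral>\<^sup>+y. indicator A (x, y) \<partial>Q x)"
      unfolding J_eq by (rule nn_integral_distr) auto
    also have "\<dots> = q x" unfolding q_def by (rule nn_integral_Q) simp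
    finally show ?thesis .
  qed
  have "emeasure (distr ?\<pi> borel fst \<bind> J) A = (\<integral>\<^sup>+x. q x \<partial>distr ?\<pi> borel fst)"
    by (subst emeasure_bind[OF ne, where N=borel]) (auto simp: EJ)
  also have "\<dots> = (\<integral>\<^sup>+z. q (fst z) \<partial>?\<pi>)"
    by (rule nn_integral_distr) (auto simp: measurable_cong_sets[OF s refl] fst_snd_measurable)
  also have "\<dots> = (\<integral>\<^sup>+x. (\<integral>\<^sup>+y. c x * (ennreal (W x y) * q x) \<partial>lborel) \<partial>lborel)"
    by (subst nn) (auto intro!: measurable_compose[OF fst_snd_measurable(1)])
  \<comment> \<open>For fixed \<open>x\<close> the integral of the weight over \<open>y\<close> is
    \<open>Z x\<close>, which cancels the normaliser inside \<open>q x\<close>.\<close>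
  also have "\<dots> = (\<integral>\<^sup>+x. (\<integral>\<^sup>+y. c x * (ennreal (W x y) * indicator A (x, y)) \<partial>lborel) \<partial>lborel)"
  proof (rule nn_integral_cong)
    fix x
    have "(\<integral>\<^sup>+y. ennreal (W x y) \<partial>lborel) = ennreal (Z x)"
      unfolding Z_def using W_integrable W_pos by (intro nn_integral_eq_integral) (auto intro!: AE_I2 less_imp_le)
    moreover have "ennreal (Z x) * q x = (\<integral>\<^sup>+y. ennreal (W x y) * indicator A (x, y) \<partial>lborel)"
      unfolding q_def
      by (subst nn_integral_cmult[symmetric], simp, rule nn_integral_cong)
        (use Z_pos[of x] W_pos[of x] in \<open>auto simp: mult.assoc[symmetric] ennreal_mult[symmetric] less_imp_le intro!: arg_cong2[where f="(*)"]\<close>)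
    ultimately show "(\<integral>\<^sup>+y. c x * (ennreal (W x y) * q x) \<partial>lborel) = (\<integral>\<^sup>+y. c x * (ennreal (W x y) * indicator A (x, y)) \<partial>lborel)"
      by (simp add: nn_integral_cmult nn_integral_multc)
  qed
  also have "\<dots> = (\<integral>\<^sup>+z. indicator A z \<partial>?\<pi>)"
    by (subst nn) auto
  also have "\<dots> = emeasure ?\<pi> A" by (simp add: s)
  finally show "emeasure ?\<pi> A = emeasure (distr ?\<pi> borel fst \<bind> J) A" by simp
qed

text \<open>Half of stationarity: one draw carries the first marginal to the second. Swapping
  coordinates gives the way back.\<close>

lemma gibbs_target_snd:
  assumes "integrable lborel (gibbs_joint_unnorm \<eta> f h)" "f \<in> borel_measurable borel"
  shows "distr (gibbs_target \<eta> f h) borel snd = distr (gibbs_target \<eta> f h) borel fst \<bind> Q"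
proof -
  let ?\<pi>X = "distr (gibbs_target \<eta> f h) borel fst"
  have "distr (gibbs_target \<eta> f h) borel snd = distr (?\<pi>X \<bind> J) borel snd"
    using gibbs_target_disintegration[OF assms] by simp
  also have "\<dots> = ?\<pi>X \<bind> (\<lambda>x. distr (J x) borel snd)"
    by (rule distr_bind[where K=borel]) (auto simp: fst_snd_measurable)
  also have "(\<lambda>x. distr (J x) borel snd) = Q"
  proof
    fix x
    show "distr (J x) borel snd = Q x"
      unfolding J_eq by (subst distr_distr) (auto simp: fst_snd_measurable comp_def intro!: distr_id2)
  qed
  finally show ?thesis .
qed

end

section \<open>Convergence of the sampler\<close>

text \<open>The invariant of the induction: \<open>a\<close> and \<open>p\<close> are pull-backs of
  \<open>u\<close> and \<open>exp u\<close> through the chain, and \<open>n\<close> counts kernels.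
  The bounds by \<open>B\<close> pass unchanged through every kernel and keep all integrals and
  logarithms finite. At \<open>n = 0\<close> the content is the diagonal inequality.\<close>

definition log_Harnack_pair :: "real \<Rightarrow> real \<Rightarrow> nat \<Rightarrow> ('a::euclidean_space \<Rightarrow> real) \<Rightarrow> ('a \<Rightarrow> real) \<Rightarrow> bool" where
  "log_Harnack_pair \<eta> B n a p \<longleftrightarrow>
     a \<in> borel_measurable borel \<and> p \<in> borel_measurable borel \<and>
     (\<forall>y. \<bar>a y\<bar> \<le> B) \<and> (\<forall>y. exp (- B) \<le> p y) \<and> (\<forall>y. p y \<le> exp B) \<and>
     (\<forall>y. a y \<le> ln (p y)) \<and>
     (\<forall>y y'. 2 * real n * \<eta> * (a y - ln (p y')) \<le> (norm (y - y'))\<^sup>2)"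

context proximal_kernel
begin

text \<open>Jensen's inequality at a common \<open>x\<close> is what the final draw gives, because
  \<open>u\<close> also depends on \<open>x\<close>; hence the count 0.\<close>

lemma log_Harnack_pair_base:
  fixes u :: "'a \<times> 'a \<Rightarrow> real"
  assumes u [measurable]: "u \<in> borel_measurable borel" and bdd: "\<And>z. \<bar>u z\<bar> \<le> B"
  shows "log_Harnack_pair \<eta> B 0 (\<lambda>x. \<integral>y. u (x, y) \<partial>Q x) (\<lambda>x. \<integral>y. exp (u (x, y)) \<partial>Q x)"
proof -
  have [measurable]: "(\<lambda>y. u (x, y)) \<in> borel_measurable borel" for x by measurable
  have b: "- B \<le> u z" "u z \<le> B" for z using bdd[of z] by auto
  have 1: "\<bar>\<integral>y. u (x, y) \<partial>Q x\<bar> \<le> B" for x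
    using integral_Q_bounds[of "\<lambda>y. u (x, y)" "- B" B x] b by (simp add: abs_le_iff)
  have 2: "exp (- B) \<le> (\<integral>y. exp (u (x, y)) \<partial>Q x)" "(\<integral>y. exp (u (x, y)) \<partial>Q x) \<le> exp B" for x
    using integral_Q_bounds[of "\<lambda>y. exp (u (x, y))" "exp (- B)" "exp B" x] b by auto
  have 3: "(\<integral>y. u (x, y) \<partial>Q x) \<le> ln (\<integral>y. exp (u (x, y)) \<partial>Q x)" for x
  proof -
    have "integrable (Q x) (\<lambda>y. exp (u (x, y)))"
      using b by (intro integrable_Q_bounded[where B="exp B"]) auto
    moreover have "integrable (Q x) (\<lambda>y. u (x, y))"
      using bdd by (intro integrable_Q_bounded[where B=B]) auto
    ultimately show ?thesis
      using prob_space.expectation_le_ln[OF prob_space_Q, of x "\<lambda>y. exp (u (x, y))"] by simp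
  qed
  show ?thesis
    unfolding log_Harnack_pair_def
    using 1 2 3 integral_Q_pair_measurable[OF u] integral_Q_pair_measurable[of "\<lambda>z. exp (u z)"] by simp
qed

lemma log_Harnack_pair_step:
  assumes "log_Harnack_pair \<eta> B n a p"
  shows "log_Harnack_pair \<eta> B (Suc n) (\<lambda>x. \<integral>y. a y \<partial>Q x) (\<lambda>x. \<integral>y. p y \<partial>Q x)"
proof -
  have m: "a \<in> borel_measurable borel" "p \<in> borel_measurable borel"
    and bdd: "\<And>y. \<bar>a y\<bar> \<le> B" "\<And>y. exp (- B) \<le> p y" "\<And>y. p y \<le> exp B"
    and ab: "\<And>y. a y \<le> ln (p y)" "\<And>y y'. 2 * real n * \<eta> * (a y - ln (p y')) \<le> (norm (y - y'))\<^sup>2"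
    using assms unfolding log_Harnack_pair_def by blast+
  note off = log_Harnack_step[OF m bdd ab]
  \<comment> \<open>The diagonal inequality is recovered from the new off-diagonal one at equal
    points, its coefficient now being positive.\<close>
  have diag: "(\<integral>y. a y \<partial>Q x) \<le> ln (\<integral>y. p y \<partial>Q x)" for x
  proof -
    have "(2 * real (Suc n) * \<eta>) * ((\<integral>y. a y \<partial>Q x) - ln (\<integral>y. p y \<partial>Q x)) \<le> 0"
      using off[of x x] by simp
    moreover have "0 < 2 * real (Suc n) * \<eta>" using eta_pos by simp
    ultimately show ?thesis
      using mult_le_cancel_left_pos[of "2 * real (Suc n) * \<eta>" _ 0] by simp
  qed
  have "\<bar>\<integral>y. a y \<partial>Q x\<bar> \<le> B" for x
    using integral_Q_bounds[OF m(1), of "- B" B x] bdd(1) by (simp add: abs_le_iff) (smt (verit))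
  then show ?thesis
    unfolding log_Harnack_pair_def
    using integral_Q_measurable[OF m(1)] integral_Q_measurable[OF m(2)] off diag
      integral_Q_bounds[OF m(2) bdd(2,3)] by blast
qed

end

text \<open>One pair must serve all initial laws: the induction step applies it to the law after one
  sweep, and the final bound to both the given initial law and the stationary one.\<close>

lemma gibbs_law_log_Harnack:
  fixes u :: "'a::euclidean_space \<times> 'a \<Rightarrow> real"
  assumes "proximal_kernel \<eta> f" "proximal_kernel \<eta> g"
    and u: "u \<in> borel_measurable borel" and bdd: "\<And>z. \<bar>u z\<bar> \<le> B"
  shows "\<exists>a p. log_Harnack_pair \<eta> B (2 * k) a p \<and>
    (\<forall>\<mu>. prob_space \<mu> \<longrightarrow> sets \<mu> = sets borel \<longrightarrow>
      (\<integral>z. u z \<partial>gibbs_law_XY \<eta> f g \<mu> k) = (\<integral>x. a x \<partial>\<mu>) \<and>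
      (\<integral>z. exp (u z) \<partial>gibbs_law_XY \<eta> f g \<mu> k) = (\<integral>x. p x \<partial>\<mu>))"
proof -
  interpret R: proximal_kernel \<eta> f by fact
  interpret K: proximal_kernel \<eta> g by fact
  show ?thesis
  proof (induction k)
    case 0
    have "gibbs_law_XY \<eta> f g \<mu> 0 = \<mu> \<bind> K.J" for \<mu>
      by (simp add: gibbs_law_XY_def gibbs_law_X_def K.J_def[abs_def])
    moreover have "\<bar>exp (u z)\<bar> \<le> exp B" for z using bdd[of z] by (simp add: abs_le_iff)
    ultimately show ?case
      using K.log_Harnack_pair_base[OF u bdd] K.integral_bind_J[OF _ _ u bdd] u
        K.integral_bind_J[of _ "\<lambda>z. exp (u z)" "exp B"]
      by (intro exI[of _ "\<lambda>x. \<integral>y. u (x, y) \<partial>K.Q x"] exI[of _ "\<lambda>x. \<integral>y. exp (u (x, y)) \<partial>K.Q x"]) simp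
  next
    case (Suc k)
    then obtain a p where pair: "log_Harnack_pair \<eta> B (2 * k) a p"
      and law: "\<And>\<mu>. prob_space \<mu> \<Longrightarrow> sets \<mu> = sets borel \<Longrightarrow>
        (\<integral>z. u z \<partial>gibbs_law_XY \<eta> f g \<mu> k) = (\<integral>x. a x \<partial>\<mu>)"
        "\<And>\<mu>. prob_space \<mu> \<Longrightarrow> sets \<mu> = sets borel \<Longrightarrow>
        (\<integral>z. exp (u z) \<partial>gibbs_law_XY \<eta> f g \<mu> k) = (\<integral>x. p x \<partial>\<mu>)"
      by blast
    \<comment> \<open>Pull-back runs against time: the \<open>f\<close>-draw ends the sweep, so its
      kernel \<open>R.Q\<close> acts on the functions first.\<close>
    note pair1 = R.log_Harnack_pair_step[OF pair]
    note pair2 = K.log_Harnack_pair_step[OF pair1]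
    have abs_p: "\<bar>q y\<bar> \<le> exp B" if "log_Harnack_pair \<eta> B n b q" for n b q and y :: 'a
      using that exp_gt_zero[of "- B"] unfolding log_Harnack_pair_def
      by (metis abs_of_nonneg less_imp_le order_trans)
    \<comment> \<open>The first sweep is split off, not the last, and absorbed into the initial
      law.\<close>
    have step: "gibbs_law_XY \<eta> f g \<mu> (Suc k) = gibbs_law_XY \<eta> f g (\<mu> \<bind> K.Q \<bind> R.Q) k" for \<mu>
      by (simp add: gibbs_law_XY_def gibbs_law_X_def funpow_swap1 gibbs_step_def)
    have two: "(\<integral>x. \<phi> x \<partial>(\<mu> \<bind> K.Q \<bind> R.Q)) = (\<integral>x. (\<integral>y. (\<integral>w. \<phi> w \<partial>R.Q y) \<partial>K.Q x) \<partial>\<mu>)"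
      if "prob_space \<mu>" "sets \<mu> = sets borel" "\<phi> \<in> borel_measurable borel" "\<And>y. \<bar>\<phi> y\<bar> \<le> C"
        "\<And>y. \<bar>\<integral>w. \<phi> w \<partial>R.Q y\<bar> \<le> C" for \<mu> and \<phi> :: "'a \<Rightarrow> real" and C
    proof -
      note b = K.prob_space_bind_Q[OF that(1,2)]
      show ?thesis
        using R.integral_bind_Q[OF b that(3,4)]
          K.integral_bind_Q[OF that(1,2) R.integral_Q_measurable[OF that(3)] that(5)] by simp
    qed
    have "log_Harnack_pair \<eta> B (2 * Suc k) (\<lambda>x. \<integral>y. (\<integral>w. a w \<partial>R.Q y) \<partial>K.Q x) (\<lambda>x. \<integral>y. (\<integral>w. p w \<partial>R.Q y) \<partial>K.Q x)"
      using pair2 by simp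
    moreover have "(\<integral>z. u z \<partial>gibbs_law_XY \<eta> f g \<mu> (Suc k)) = (\<integral>x. (\<integral>y. (\<integral>w. a w \<partial>R.Q y) \<partial>K.Q x) \<partial>\<mu>) \<and>
        (\<integral>z. exp (u z) \<partial>gibbs_law_XY \<eta> f g \<mu> (Suc k)) = (\<integral>x. (\<integral>y. (\<integral>w. p w \<partial>R.Q y) \<partial>K.Q x) \<partial>\<mu>)"
      if \<mu>: "prob_space \<mu>" "sets \<mu> = sets borel" for \<mu>
    proof -
      note b = R.prob_space_bind_Q[OF K.prob_space_bind_Q[OF \<mu>]]
      have "a \<in> borel_measurable borel" "p \<in> borel_measurable borel" "\<And>y. \<bar>a y\<bar> \<le> B"
        "\<And>y. \<bar>\<integral>w. a w \<partial>R.Q y\<bar> \<le> B"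
        using pair pair1 unfolding log_Harnack_pair_def by blast+
      then show ?thesis
        using law[OF b] two[OF \<mu>, of a B] two[OF \<mu>, of p "exp B"] abs_p[OF pair] abs_p[OF pair1]
        by (simp add: step)
    qed
    ultimately show ?case by blast
  qed
qed

section \<open>Stationarity and the final bound\<close>

lemma prob_space_gibbs_target:
  assumes int: "integrable lborel (gibbs_joint_unnorm \<eta> f g)"
  shows "prob_space (gibbs_target \<eta> f g)"
proof
  let ?J = "gibbs_joint_unnorm \<eta> f g"
  let ?N = "\<integral>w. ?J w \<partial>lborel"
  have J0: "0 < ?J z" for z by (simp add: gibbs_joint_unnorm_def)
  have "?N \<noteq> 0"
  proof
    assume "?N = 0"
    then have "AE y in lborel. ?J y = 0"
      using int J0 by (subst (asm) integral_nonneg_eq_0_iff_AE) (auto intro!: AE_I2 less_imp_le)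
    then have "AE y in (lborel :: ('a \<times> 'a) measure). False"
      by eventually_elim (use J0 in \<open>metis less_irrefl\<close>)
    then show False by (simp add: AE_iff_null null_sets_def)
  qed
  moreover have "0 \<le> ?N" by (intro Bochner_Integration.integral_nonneg less_imp_le J0)
  ultimately have N: "0 < ?N" by simp
  have "emeasure (gibbs_target \<eta> f g) (space (gibbs_target \<eta> f g)) = (\<integral>\<^sup>+z. ennreal (?J z / ?N) \<partial>lborel)"
    unfolding gibbs_target_def using int[THEN borel_measurable_integrable] by (subst emeasure_density) auto
  also have "\<dots> = ennreal (\<integral>z. ?J z / ?N \<partial>lborel)"
    using int J0 N by (intro nn_integral_eq_integral) (auto intro!: AE_I2 less_imp_le)
  also have "(\<integral>z. ?J z / ?N \<partial>lborel) = 1" using N by simp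
  finally show "emeasure (gibbs_target \<eta> f g) (space (gibbs_target \<eta> f g)) = 1" by simp
qed

text \<open>Each half-step carries one marginal of the target to the other, so a sweep fixes the
  first marginal; the last draw then rebuilds the joint law by disintegration.\<close>

lemma gibbs_law_stationary:
  assumes "proximal_kernel \<eta> f" "proximal_kernel \<eta> g"
    and int: "integrable lborel (gibbs_joint_unnorm \<eta> f g)"
  shows "gibbs_law_XY \<eta> f g (distr (gibbs_target \<eta> f g) borel fst) k = gibbs_target \<eta> f g"
proof -
  interpret R: proximal_kernel \<eta> f by fact
  interpret K: proximal_kernel \<eta> g by fact
  let ?\<pi> = "gibbs_target \<eta> f g"
  have s: "sets ?\<pi> = sets borel" by (simp add: gibbs_target_def)
  have Y: "distr ?\<pi> borel snd = distr ?\<pi> borel fst \<bind> K.Q"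
    by (rule K.gibbs_target_snd[OF int R.h_measurable])
  have swap: "distr (gibbs_target \<eta> g f) borel fst = distr ?\<pi> borel snd"
    "distr (gibbs_target \<eta> g f) borel snd = distr ?\<pi> borel fst"
    unfolding gibbs_target_swap[OF int]
    by (subst distr_distr; simp add: fst_snd_measurable swap_measurable measurable_cong_sets[OF s refl] comp_def)+
  have X: "distr ?\<pi> borel fst = distr ?\<pi> borel snd \<bind> R.Q"
    using R.gibbs_target_snd[OF gibbs_joint_swap_integrable[OF int] K.h_measurable] by (simp add: swap)
  have "gibbs_step \<eta> f g (distr ?\<pi> borel fst) = distr ?\<pi> borel fst"
    by (simp only: gibbs_step_def Y[symmetric] X[symmetric])
  then have "gibbs_law_X \<eta> f g (distr ?\<pi> borel fst) k = distr ?\<pi> borel fst"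
    unfolding gibbs_law_X_def by (induction k) auto
  then show ?thesis
    using K.gibbs_target_disintegration[OF int R.h_measurable]
    by (simp add: gibbs_law_XY_def K.J_def[abs_def])
qed

lemma prob_space_gibbs_law:
  assumes "proximal_kernel \<eta> f" "proximal_kernel \<eta> g" "prob_space \<mu>" "sets \<mu> = sets borel"
  shows "prob_space (gibbs_law_XY \<eta> f g \<mu> k)" "sets (gibbs_law_XY \<eta> f g \<mu> k) = sets borel"
proof -
  interpret R: proximal_kernel \<eta> f by fact
  interpret K: proximal_kernel \<eta> g by fact
  have X: "prob_space (gibbs_law_X \<eta> f g \<mu> k) \<and> sets (gibbs_law_X \<eta> f g \<mu> k) = sets borel"
    unfolding gibbs_law_X_def
  proof (induction k)
    case (Suc k)
    then show ?case
      by (simp add: gibbs_step_def R.prob_space_bind_Q K.prob_space_bind_Q)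
  qed (use assms in simp)
  have eq: "gibbs_law_XY \<eta> f g \<mu> k = gibbs_law_X \<eta> f g \<mu> k \<bind> K.J"
    by (simp add: gibbs_law_XY_def K.J_def[abs_def])
  show "sets (gibbs_law_XY \<eta> f g \<mu> k) = sets borel"
    unfolding eq using X by (intro sets_bind) (auto simp: K.J_eq prob_space.not_empty)
  show "prob_space (gibbs_law_XY \<eta> f g \<mu> k)"
    unfolding eq using X
    by (intro prob_space.prob_space_bind[where S=borel]) (auto simp: K.prob_space_J measurable_cong_sets[OF conjunct2[OF X] refl])
qed

text \<open>The pointwise inequality for a pair with \<open>n = 2 * k\<close> is integrated against
  the coupling, its first argument carrying the initial law and its second the stationary
  one.\<close>

lemma KL_div_gibbs_le_coupling:
  fixes f g :: "'a::euclidean_space \<Rightarrow> real" and \<gamma> :: "('a \<times> 'a) measure"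
  assumes "proximal_kernel \<eta> f" "proximal_kernel \<eta> g"
    and int: "integrable lborel (gibbs_joint_unnorm \<eta> f g)"
    and \<mu>: "prob_space \<mu>" "sets \<mu> = sets borel" and k: "k \<ge> 1"
    and \<gamma>: "\<gamma> \<in> couplings \<mu> (distr (gibbs_target \<eta> f g) borel fst)"
    and cost: "integrable \<gamma> (\<lambda>z. (norm (fst z - snd z))\<^sup>2)"
  shows "KL_div (gibbs_law_XY \<eta> f g \<mu> k) (gibbs_target \<eta> f g)
    \<le> ereal ((\<integral>z. (norm (fst z - snd z))\<^sup>2 \<partial>\<gamma>) / (4 * real k * \<eta>))"
proof (rule KL_div_le_of_variational)
  let ?\<pi> = "gibbs_target \<eta> f g"
  let ?\<pi>X = "distr ?\<pi> borel fst"
  have s: "sets ?\<pi> = sets borel" by (simp add: gibbs_target_def)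
  interpret \<pi>: prob_space ?\<pi> by (rule prob_space_gibbs_target[OF int])
  show "prob_space ?\<pi>" by (rule \<pi>.prob_space_axioms)
  show "prob_space (gibbs_law_XY \<eta> f g \<mu> k)" by (rule prob_space_gibbs_law[OF assms(1,2) \<mu>])
  show "sets (gibbs_law_XY \<eta> f g \<mu> k) = sets ?\<pi>" by (simp add: s prob_space_gibbs_law[OF assms(1,2) \<mu>])
  have \<pi>X: "prob_space ?\<pi>X" by (rule \<pi>.prob_space_distr) (simp add: measurable_cong_sets[OF s refl] fst_snd_measurable)
  have eta: "\<eta> > 0" using assms(1) by (simp add: proximal_kernel_def)
  have sg: "sets \<gamma> = sets borel" and g1: "distr \<gamma> borel fst = \<mu>" and g2: "distr \<gamma> borel snd = ?\<pi>X"
    using \<gamma> by (auto simp: couplings_def)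
  have mf: "fst \<in> \<gamma> \<rightarrow>\<^sub>M borel" "snd \<in> \<gamma> \<rightarrow>\<^sub>M borel"
    by (simp_all add: measurable_cong_sets[OF sg refl] fst_snd_measurable)
  interpret G: prob_space \<gamma>
    using prob_space_distrD[OF mf(1)] \<mu>(1) g1 by simp
  fix u :: "'a \<times> 'a \<Rightarrow> real" and B
  assume "u \<in> borel_measurable ?\<pi>" and bdd: "\<And>x. \<bar>u x\<bar> \<le> B"
  then have u: "u \<in> borel_measurable borel" by (simp add: measurable_cong_sets[OF s refl])
  obtain a p where pair: "log_Harnack_pair \<eta> B (2 * k) a p"
    and law: "\<And>\<mu>. prob_space \<mu> \<Longrightarrow> sets \<mu> = sets borel \<Longrightarrow>
        (\<integral>z. u z \<partial>gibbs_law_XY \<eta> f g \<mu> k) = (\<integral>x. a x \<partial>\<mu>)"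
        "\<And>\<mu>. prob_space \<mu> \<Longrightarrow> sets \<mu> = sets borel \<Longrightarrow>
        (\<integral>z. exp (u z) \<partial>gibbs_law_XY \<eta> f g \<mu> k) = (\<integral>x. p x \<partial>\<mu>)"
    using gibbs_law_log_Harnack[OF assms(1,2) u bdd, of k] by blast
  have m [measurable]: "a \<in> borel_measurable borel" "p \<in> borel_measurable borel"
    and ab: "\<And>y. \<bar>a y\<bar> \<le> B" "\<And>y. exp (- B) \<le> p y" "\<And>y. p y \<le> exp B"
    and har: "\<And>y y'. 2 * real (2 * k) * \<eta> * (a y - ln (p y')) \<le> (norm (y - y'))\<^sup>2"
    using pair unfolding log_Harnack_pair_def by blast+
  have p0: "0 < p y" for y using ab(2) exp_gt_zero less_le_trans by blast
  have lnp: "\<bar>ln (p y)\<bar> \<le> B" for y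
  proof -
    have "- B \<le> ln (p y)" using ab(2) p0 by (simp add: ln_ge_iff)
    moreover have "ln (p y) \<le> B" using ab(3) p0 by (metis ln_exp ln_le_cancel_iff exp_gt_zero)
    ultimately show ?thesis by simp
  qed
  have c: "0 < 4 * real k * \<eta>" using k eta by simp
  have ma: "(\<lambda>z. a (fst z)) \<in> borel_measurable \<gamma>" and mp: "(\<lambda>z. p (snd z)) \<in> borel_measurable \<gamma>"
    and mlp: "(\<lambda>z. ln (p (snd z))) \<in> borel_measurable \<gamma>"
    using measurable_compose[OF mf(1) m(1)] measurable_compose[OF mf(2) m(2)] by simp_all
  have ilp: "integrable \<gamma> (\<lambda>z. ln (p (snd z)))"
    using lnp mlp by (intro G.integrable_const_bound[where B=B]) auto
  have "(\<integral>z. u z \<partial>gibbs_law_XY \<eta> f g \<mu> k) = (\<integral>x. a x \<partial>\<mu>)"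
    by (rule law(1)[OF \<mu>])
  also have "\<dots> = (\<integral>z. a (fst z) \<partial>\<gamma>)"
    unfolding g1[symmetric] by (rule integral_distr[OF mf(1) m(1)])
  also have "\<dots> \<le> (\<integral>z. ln (p (snd z)) + (norm (fst z - snd z))\<^sup>2 / (4 * real k * \<eta>) \<partial>\<gamma>)"
  proof (rule integral_mono)
    show "integrable \<gamma> (\<lambda>z. a (fst z))"
      using ab ma by (intro G.integrable_const_bound[where B=B]) auto
    show "integrable \<gamma> (\<lambda>z. ln (p (snd z)) + (norm (fst z - snd z))\<^sup>2 / (4 * real k * \<eta>))"
      using cost ilp by simp
    fix z
    have "(4 * real k * \<eta>) * (a (fst z) - ln (p (snd z))) \<le> (norm (fst z - snd z))\<^sup>2"
      using har[of "fst z" "snd z"] by (simp add: mult_ac)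
    then have "a (fst z) - ln (p (snd z)) \<le> (norm (fst z - snd z))\<^sup>2 / (4 * real k * \<eta>)"
      using c by (simp add: pos_le_divide_eq mult.commute)
    then show "a (fst z) \<le> ln (p (snd z)) + (norm (fst z - snd z))\<^sup>2 / (4 * real k * \<eta>)" by linarith
  qed
  also have "\<dots> = (\<integral>z. ln (p (snd z)) \<partial>\<gamma>) + (\<integral>z. (norm (fst z - snd z))\<^sup>2 \<partial>\<gamma>) / (4 * real k * \<eta>)"
    using cost ilp by (subst Bochner_Integration.integral_add) auto
  \<comment> \<open>Jensen for the concave logarithm, on the stationary side.\<close>
  also have "(\<integral>z. ln (p (snd z)) \<partial>\<gamma>) \<le> ln (\<integral>z. p (snd z) \<partial>\<gamma>)"
  proof (rule G.expectation_le_ln)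
    show "integrable \<gamma> (\<lambda>z. p (snd z))"
      using ab(3) mp p0 by (intro G.integrable_const_bound[where B="exp B"]) (auto simp: less_imp_le)
  qed (rule p0 ilp)+
  also have "(\<integral>z. p (snd z) \<partial>\<gamma>) = (\<integral>x. p x \<partial>?\<pi>X)"
    unfolding g2[symmetric] by (rule integral_distr[OF mf(2) m(2), symmetric])
  \<comment> \<open>Started from the first marginal of the target, the chain has the target as joint
    law, so \<open>p\<close> integrates to the exponential moment of \<open>u\<close>.\<close>
  also have "\<dots> = (\<integral>z. exp (u z) \<partial>?\<pi>)"
    using law(2)[OF \<pi>X] gibbs_law_stationary[OF assms(1-3)] by simp
  finally show "(\<integral>z. u z \<partial>gibbs_law_XY \<eta> f g \<mu> k) - ln (\<integral>z. exp (u z) \<partial>?\<pi>)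
    \<le> (\<integral>z. (norm (fst z - snd z))\<^sup>2 \<partial>\<gamma>) / (4 * real k * \<eta>)" by simp
qed

theorem mainTheorem5:
  fixes \<eta> :: real and f g :: "'a::euclidean_space \<Rightarrow> real" and \<mu>0 :: "'a measure" and k :: nat
  assumes eta_pos: "\<eta> > 0"
    and f_convex: "convex_on UNIV f" and g_convex: "convex_on UNIV g"
    and normalizable: "integrable lborel (gibbs_joint_unnorm \<eta> f g)"
    and second_moment_pi: "integrable lborel (\<lambda>z. (norm z)\<^sup>2 * gibbs_joint_unnorm \<eta> f g z)"
    and mu0_prob: "prob_space \<mu>0" and mu0_sets: "sets \<mu>0 = sets borel"
    and second_moment_mu0: "integrable \<mu>0 (\<lambda>x. (norm x)\<^sup>2)"
    and k_ge: "k \<ge> 1"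
  shows "KL_div (gibbs_law_XY \<eta> f g \<mu>0 k) (gibbs_target \<eta> f g)
           \<le> enn2ereal (W2sq \<mu>0 (distr (gibbs_target \<eta> f g) borel fst) / ennreal (real k * \<eta>))"
proof -
  have f: "proximal_kernel \<eta> f"
    using eta_pos f_convex gibbs_weight_integrable[OF gibbs_joint_swap_integrable[OF normalizable]
        convex_on_UNIV_borel_measurable[OF f_convex]]
    by unfold_locales
  have g: "proximal_kernel \<eta> g"
    using eta_pos g_convex gibbs_weight_integrable[OF normalizable convex_on_UNIV_borel_measurable[OF g_convex]]
    by unfold_locales
  let ?KL = "KL_div (gibbs_law_XY \<eta> f g \<mu>0 k) (gibbs_target \<eta> f g)"
  let ?\<pi>X = "distr (gibbs_target \<eta> f g) borel fst"
  let ?c = "real k * \<eta>"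
  have c: "?c > 0" using eta_pos k_ge by simp
  \<comment> \<open>With the denominator on the left the claim is a lower bound for an infimum, so
    each coupling can be treated alone.\<close>
  have "e2ennreal ?KL * ennreal ?c \<le> W2sq \<mu>0 ?\<pi>X"
    unfolding W2sq_def
  proof (rule INF_greatest)
    fix \<gamma> assume \<gamma>: "\<gamma> \<in> couplings \<mu>0 ?\<pi>X"
    let ?d = "\<lambda>z::'a \<times> 'a. (norm (fst z - snd z))\<^sup>2"
    show "e2ennreal ?KL * ennreal ?c \<le> (\<integral>\<^sup>+ z. ennreal (?d z) \<partial>\<gamma>)"
    \<comment> \<open>For infinite cost the bound is trivial; finite cost supplies the integrability
      that \<open>KL_div_gibbs_le_coupling\<close> asks for.\<close>
    proof (cases "(\<integral>\<^sup>+ z. ennreal (?d z) \<partial>\<gamma>) = \<infinity>")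
      case False
      have sg: "sets \<gamma> = sets borel" using \<gamma> by (simp add: couplings_def)
      have m: "?d \<in> borel_measurable \<gamma>"
        unfolding measurable_cong_sets[OF sg refl]
        by (intro borel_measurable_continuous_onI continuous_intros)
      then have cost: "integrable \<gamma> ?d"
        using False by (intro integrableI_nonneg) (auto simp: top.not_eq_extremum)
      have "?KL \<le> ereal ((\<integral>z. ?d z \<partial>\<gamma>) / (4 * real k * \<eta>))"
        by (rule KL_div_gibbs_le_coupling[OF f g normalizable mu0_prob mu0_sets k_ge \<gamma> cost])
      then have "e2ennreal ?KL \<le> ennreal ((\<integral>z. ?d z \<partial>\<gamma>) / (4 * real k * \<eta>))"
        by (metis e2ennreal_mono e2ennreal_ereal)
      then have "e2ennreal ?KL * ennreal ?c \<le> ennreal ((\<integral>z. ?d z \<partial>\<gamma>) / (4 * real k * \<eta>)) * ennreal ?c"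
        by (rule mult_right_mono) simp
      also have "\<dots> = ennreal ((\<integral>z. ?d z \<partial>\<gamma>) / 4)"
        using c eta_pos k_ge by (subst ennreal_mult[symmetric]) (auto simp: Bochner_Integration.integral_nonneg)
      \<comment> \<open>The surplus factor 4 in the rate is given away here.\<close>
      also have "\<dots> \<le> ennreal (\<integral>z. ?d z \<partial>\<gamma>)"
        using Bochner_Integration.integral_nonneg[of \<gamma> ?d] by (intro ennreal_leI) simp
      also have "\<dots> = (\<integral>\<^sup>+ z. ennreal (?d z) \<partial>\<gamma>)"
        using cost by (intro nn_integral_eq_integral[symmetric]) auto
      finally show ?thesis .
    qed simp
  qed
  then have "e2ennreal ?KL * ennreal ?c / ennreal ?c \<le> W2sq \<mu>0 ?\<pi>X / ennreal ?c"
    by (rule divide_right_mono_ennreal)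
  then have "e2ennreal ?KL \<le> W2sq \<mu>0 ?\<pi>X / ennreal ?c"
    using c by (simp only: ennreal_mult_divide_eq ennreal_neq_top ennreal_eq_0_iff not_le not_False_eq_True)
  then have "enn2ereal (e2ennreal ?KL) \<le> enn2ereal (W2sq \<mu>0 ?\<pi>X / ennreal ?c)"
    by (simp add: less_eq_ennreal.rep_eq)
  \<comment> \<open>\<open>e2ennreal\<close> sends negative values to 0, which can only increase
    them, so the passage through \<open>ennreal\<close> preserves the upper bound.\<close>
  moreover have "?KL \<le> enn2ereal (e2ennreal ?KL)"
    by (cases "0 \<le> ?KL") (simp_all add: enn2ereal_e2ennreal e2ennreal_neg zero_ennreal.rep_eq)
  ultimately show ?thesis by (rule order_trans[rotated])
qed

end
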